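(* Let $n\ge 1$ with $n\ne 2$. (a) The minimum number of nonzero entries of an $n\times n$ connected ASM equals $2n-1$ if $n$ is odd and $2n$ if $n$ is even. (b) If $n$ is odd, an $n\times n$ connected ASM $A$ has exactly $2n-1$ nonzero entries if and only if $A=I_1$ or $A$ can be obtained from $I_1$ by recursively attaching $D_3$'s, i.e., there is a sequence $I_1=A_0,A_1,\dots,A_t=A$ with each $A_{s+1}$ obtained from $A_s$ by attaching $D_3$. (c) If $n$ is even, an $n\times n$ connected ASM $A$ has exactly $2n$ nonzero entries if and only if $A$ is a basic unicyclic ASM or $A$ can be obtained from a basic unicyclic ASM by recursively attaching $D_3$'s.
   Context: An alternating sign matrix (ASM) is a square matrix with entries in $\{0,+1,-1\}$ such that in each row and each column the nonzero entries alternate in sign, beginning and ending with $+1$. For an $n\times n$ ASM $A=[a_{ij}]$, $BG(A)$ is the signed bipartite graph with vertex set $\{r_1,\dots,r_n\}\cup\{c_1,\dots,c_n\}$ having an edge $r_ic_j$ of sign $a_{ij}$ exactly when $a_{ij}\neq 0$; $A$ is connected if $BG(A)$ is connected. $I_1=[+1]$. $D_3=\begin{bmatrix}0&+1&0\\+1&-1&+1\\0&+1&0\end{bmatrix}$. Attaching $D_3$: given an $n\times n$ ASM $A$ and an entry $a_{ij}=+1$, an $(n+2)\times(n+2)$ matrix $B$ is obtained from $A$ by attaching $D_3$ if $B$ is an ASM and $B$ arises from $A$ by inserting two new rows and two new columns (anywhere, not necessarily consecutive, keeping the relative order of the old rows and columns) such that: there are rows $\rho_1<\rho_2<\rho_3$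 and columns $\gamma_1<\gamma_2<\gamma_3$ of $B$ with the $3\times 3$ submatrix of $B$ on these rows and columns equal to $D_3$; the entry of $B$ coming from $a_{ij}$ is one of the four $+1$ entries of this submatrix, its row and column are old and the other two of the $\rho$'s and other two of the $\gamma$'s are the new rows and columns; and all other entries of $B$ in the new rows and new columns are $0$. Basic unicyclic ASM: an $n\times n$ ASM $A$ such that $BG(A)$ consists of a cycle $C$ of length $2m$ with $m\ge 2$ (edges signed arbitrarily) together with, for each vertex $v$ of $C$: if both edges of $C$ at $v$ are positive, a new vertex $w$ joined to $v$ by a negative edge and two further new vertices joined to $w$ by positive edges; if exactly one edge of $C$ at $v$ is positive, one new vertex joined to $v$ by a positive edge; if both edges of $C$ at $v$ are negative, three new vertices joined to $v$ by positive edges; and no other vertices or edges. *)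

theory Defs
  imports "Jordan_Normal_Form.Matrix" "Graph_Theory.Graph_Theory"
begin

definition alternating :: "int vec \<Rightarrow> bool" where
  "alternating v \<longleftrightarrow>
     (let xs = filter (\<lambda>x. x \<noteq> 0) (list_of_vec v)
      in xs \<noteq> [] \<and> hd xs = 1 \<and> last xs = 1 \<and> successively (\<lambda>x y. y = - x) xs)"

definition is_asm :: "int mat \<Rightarrow> bool" where
  "is_asm A \<longleftrightarrow>
     square_mat A \<and> elements_mat A \<subseteq> {0, 1, -1} \<and>
     (\<forall>i < dim_row A. alternating (row A i)) \<and>
     (\<forall>j < dim_col A. alternating (col A j))"

definition num_nonzero :: "int mat \<Rightarrow> nat" where
  "num_nonzero A = card {(i, j). i < dim_row A \<and> j < dim_col A \<and> A $$ (i, j) \<noteq> 0}"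

text \<open>A signed simple graph; an undirected edge is the set of its two end vertices.\<close>

record 'v signed_graph =
  sg_verts :: "'v set"
  pos_edges :: "'v set set"
  neg_edges :: "'v set set"

text \<open>The underlying unsigned graph, as a symmetric digraph.\<close>

definition underlying :: "'v signed_graph \<Rightarrow> 'v pair_pre_digraph" where
  "underlying G =
     \<lparr> pverts = sg_verts G, parcs = {(u, v). {u, v} \<in> pos_edges G \<union> neg_edges G} \<rparr>"

datatype bg_vertex = Row nat | Col nat

definition BG :: "int mat \<Rightarrow> bg_vertex signed_graph" where
  "BG A =
     \<lparr> sg_verts = Row ` {..<dim_row A} \<union> Col ` {..<dim_col A},
       pos_edges = {{Row i, Col j} | i j. i < dim_row A \<and> j < dim_col A \<and> A $$ (i, j) = 1},
       neg_edges = {{Row i, Col j} | i j. i < dim_row A \<and> j < dim_col A \<and> A $$ (i, j) = -1} \<rparr>"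

definition connected_asm :: "int mat \<Rightarrow> bool" where
  "connected_asm A \<longleftrightarrow> is_asm A \<and> connected (with_proj (underlying (BG A)))"

definition D3 :: "int mat" where
  "D3 = mat_of_rows_list 3 [[0, 1, 0], [1, -1, 1], [0, 1, 0]]"

text \<open>
  Rows and columns are numbered from 0. The maps \<open>f\<close> and \<open>g\<close> send the rows and columns of \<open>A\<close>
  to the old rows and columns of \<open>B\<close>, so the new ones are those outside their images. The maps
  \<open>\<rho>\<close> and \<open>\<gamma>\<close> list the rows and columns of the submatrix \<open>D3\<close>, and \<open>(p, q)\<close> is the position
  inside \<open>D3\<close> taken by the entry coming from \<open>(i, j)\<close>.
\<close>

definition attaches_D3_at :: "nat \<Rightarrow> int mat \<Rightarrow> nat \<Rightarrow> nat \<Rightarrow> int mat \<Rightarrow> bool" where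
  "attaches_D3_at n A i j B \<longleftrightarrow>
     A \<in> carrier_mat n n \<and> is_asm A \<and> i < n \<and> j < n \<and> A $$ (i, j) = 1 \<and>
     B \<in> carrier_mat (n + 2) (n + 2) \<and> is_asm B \<and>
     (\<exists>f g \<rho> \<gamma> p q.
        strict_mono_on {..<n} f \<and> f ` {..<n} \<subseteq> {..<n + 2} \<and>
        strict_mono_on {..<n} g \<and> g ` {..<n} \<subseteq> {..<n + 2} \<and>
        (\<forall>k < n. \<forall>l < n. B $$ (f k, g l) = A $$ (k, l)) \<and>
        strict_mono_on {..<3} \<rho> \<and> \<rho> ` {..<3} \<subseteq> {..<n + 2} \<and>
        strict_mono_on {..<3} \<gamma> \<and> \<gamma> ` {..<3} \<subseteq> {..<n + 2} \<and>
        mat 3 3 (\<lambda>(k, l). B $$ (\<rho> k, \<gamma> l)) = D3 \<and>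
        p < 3 \<and> q < 3 \<and> D3 $$ (p, q) = 1 \<and> f i = \<rho> p \<and> g j = \<gamma> q \<and>
        {..<n + 2} - f ` {..<n} = \<rho> ` ({..<3} - {p}) \<and>
        {..<n + 2} - g ` {..<n} = \<gamma> ` ({..<3} - {q}) \<and>
        (\<forall>k < n + 2. \<forall>l < n + 2.
           (k \<notin> f ` {..<n} \<or> l \<notin> g ` {..<n}) \<and> \<not> (k \<in> \<rho> ` {..<3} \<and> l \<in> \<gamma> ` {..<3})
           \<longrightarrow> B $$ (k, l) = 0))"

definition attaches_D3 :: "int mat \<Rightarrow> int mat \<Rightarrow> bool" where
  "attaches_D3 A B \<longleftrightarrow> (\<exists>n i j. attaches_D3_at n A i j B)"

abbreviation attaches_D3s :: "int mat \<Rightarrow> int mat \<Rightarrow> bool" where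
  "attaches_D3s \<equiv> attaches_D3\<^sup>*\<^sup>*"

definition cycle_edges :: "'v list \<Rightarrow> 'v set set" where
  "cycle_edges vs = {{vs ! i, vs ! (Suc i mod length vs)} | i. i < length vs}"

text \<open>
  \<open>pendant k v W P N\<close>: the vertices \<open>W\<close>, positive edges \<open>P\<close> and negative edges \<open>N\<close> are what is added
  at a cycle vertex \<open>v\<close> exactly \<open>k\<close> of whose two cycle edges are positive.
\<close>

inductive pendant :: "nat \<Rightarrow> 'v \<Rightarrow> 'v set \<Rightarrow> 'v set set \<Rightarrow> 'v set set \<Rightarrow> bool" where
  both_positive: "distinct [w, x, y] \<Longrightarrow> pendant 2 v {w, x, y} {{w, x}, {w, y}} {{v, w}}"
| one_positive: "pendant 1 v {w} {{v, w}} {}"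
| both_negative: "distinct [x, y, z] \<Longrightarrow> pendant 0 v {x, y, z} {{v, x}, {v, y}, {v, z}} {}"

text \<open>
  The cycle is given by the list \<open>vs\<close> of its vertices; \<open>CP\<close> and \<open>CN\<close> are its positive and negative
  edges. That the vertices added are new means that the sets \<open>W v\<close> avoid the cycle and each other.
\<close>

definition basic_unicyclic_graph :: "'v signed_graph \<Rightarrow> bool" where
  "basic_unicyclic_graph G \<longleftrightarrow>
     (\<exists>m vs CP CN W P N.
        m \<ge> 2 \<and> length vs = 2 * m \<and> distinct vs \<and>
        CP \<union> CN = cycle_edges vs \<and> CP \<inter> CN = {} \<and>
        (\<forall>v \<in> set vs. pendant (card {e \<in> CP. v \<in> e}) v (W v) (P v) (N v)) \<and>
        (\<forall>v \<in> set vs. W v \<inter> set vs = {}) \<and>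
        (\<forall>u \<in> set vs. \<forall>v \<in> set vs. u \<noteq> v \<longrightarrow> W u \<inter> W v = {}) \<and>
        sg_verts G = set vs \<union> (\<Union>v \<in> set vs. W v) \<and>
        pos_edges G = CP \<union> (\<Union>v \<in> set vs. P v) \<and>
        neg_edges G = CN \<union> (\<Union>v \<in> set vs. N v))"

definition basic_unicyclic_asm :: "int mat \<Rightarrow> bool" where
  "basic_unicyclic_asm A \<longleftrightarrow> is_asm A \<and> basic_unicyclic_graph (BG A)"

end

theory Submission
  imports Defs
begin

text \<open>
  Since every row of an ASM sums to 1, the number of nonzero entries has the parity of \<open>n\<close>. Everything
  else comes from pruning the graph twice. Call a vertex of degree 1 a leaf; its edge is positive.
  Delete the leaves, and call a vertex that now has degree 1 a stem: in the original graph it has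
  degree 3, with two leaves and a negative edge to its remaining neighbour \<open>u\<close>. That \<open>-1\<close> lies between
  two \<open>+1\<close>s in the line \<open>u\<close>, and if one of them belongs to a leaf, then a copy of \<open>D3\<close> can be removed,
  which lowers \<open>n\<close> by 2 and the number of nonzero entries by 4. If no removal is possible, the graph
  left after deleting the stems as well (the core) has minimum degree at least 2, so there are at
  least as many edges as vertices. In the case of equality the core is a single cycle, and the sums
  at its vertices force the pendant pieces of a basic unicyclic graph. The theorem follows by
  induction on \<open>n\<close>.
\<close>

section \<open>Alternation by partial sums\<close>

text \<open>The excess \<open>num_nonzero A - 2 * n\<close> is an invariant of attaching
  \<open>D3\<close>. Undoing attachments as long as possible ends either at \<open>I_1\<close>, of
  excess -1, or at an irreducible matrix of size at least 2, of excess at least 0. So excess -1 can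
  only come from \<open>I_1\<close>, excess 0 only from irreducible matrices with equality, and
  parity tells which of the two is extremal for a given \<open>n\<close>. The obstacle is order. A
  graph forgets where rows and columns stand, yet whether a \<open>D3\<close> can be removed depends
  on which +1 is next to the -1. In an irreducible matrix the order is needed only through two lower
  bounds, on the positive edges that accompany one stem and two stems. Once these are extracted, the
  rest is graph theory that treats rows and columns alike. Size 2 is exceptional because the ASMs of
  that size are the two permutation matrices, whose graphs are disconnected.\<close>

text \<open>
  Alternation on a set \<open>I\<close> of positions. Phrasing it by partial sums makes it easy to delete
  zeros or a neighbouring pair \<open>+1, -1\<close> from \<open>I\<close>.
\<close>

definition alt_on :: "nat set \<Rightarrow> (nat \<Rightarrow> int) \<Rightarrow> bool" where
  "alt_on I f \<longleftrightarrow> (\<forall>x. sum f {y \<in> I. y < x} \<in> {0, 1}) \<and> sum f I = 1"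

text \<open>\<open>s\<close> is the sum of the entries already read.\<close>

primrec alt_from :: "int \<Rightarrow> int list \<Rightarrow> bool" where
  "alt_from s [] \<longleftrightarrow> s = 1"
| "alt_from s (y # ys) \<longleftrightarrow> s + y \<in> {0, 1} \<and> alt_from (s + y) ys"

lemma alt_from_iff_prefix_sums:
  assumes "s \<in> {0, 1}"
  shows "alt_from s ys \<longleftrightarrow>
    (\<forall>k \<le> length ys. s + sum_list (take k ys) \<in> {0, 1}) \<and> s + sum_list ys = 1"
  using assms
proof (induction ys arbitrary: s)
  case (Cons y ys)
  have "(\<forall>k \<le> length (y # ys). s + sum_list (take k (y # ys)) \<in> {0, 1}) \<longleftrightarrow>
      (\<forall>k \<le> length ys. (s + y) + sum_list (take k ys) \<in> {0, 1})"
    using Cons.prems by (simp add: All_less_Suc2 less_Suc_eq_le[symmetric] add.assoc)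
  moreover have "s + y \<in> {0, 1}" if "\<forall>k \<le> length ys. (s + y) + sum_list (take k ys) \<in> {0, 1}"
    using that[rule_format, of 0] by simp
  ultimately show ?case
    using Cons.IH[of "s + y"] by (auto simp: add.assoc)
qed simp

text \<open>The state \<open>s\<close> decides what may come next: in state 0 the next nonzero entry
  must be +1, in state 1 it is -1 or the list ends. The induction passes between the two states, so
  both are described at once.\<close>

lemma alt_from_iff_filter:
  assumes "s \<in> {0, 1}"
  shows "alt_from s ys \<longleftrightarrow>
    (let xs = filter (\<lambda>x. x \<noteq> 0) ys
     in if s = 0 then xs \<noteq> [] \<and> hd xs = 1 \<and> last xs = 1 \<and> successively (\<lambda>x y. y = - x) xs
        else xs = [] \<or> hd xs = -1 \<and> last xs = 1 \<and> successively (\<lambda>x y. y = - x) xs)"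
  using assms
proof (induction ys arbitrary: s)
  case (Cons y ys)
  show ?case
  proof (cases "s + y \<in> {0, 1}")
    case True
    show ?thesis
      using True Cons.prems Cons.IH[of "s + y"]
      by (auto simp: Let_def successively_Cons)
  next
    case False
    then show ?thesis using Cons.prems by auto
  qed
qed auto

lemma alternating_iff_alt_on: "alternating v \<longleftrightarrow> alt_on {..<dim_vec v} (($) v)"
proof -
  let ?ys = "list_of_vec v"
  have len: "length ?ys = dim_vec v" by simp
  have take: "sum_list (take k ?ys) = sum (($) v) {..<k}" if "k \<le> dim_vec v" for k
    using that
    by (simp add: sum_list_sum_nth min_def list_of_vec_index atLeast0LessThan)
  have "alternating v \<longleftrightarrow> alt_from 0 ?ys"
    by (simp add: alternating_def alt_from_iff_filter Let_def)
  also have "\<dots> \<longleftrightarrow> (\<forall>k \<le> dim_vec v. sum (($) v) {..<k} \<in> {0, 1}) \<and> sum (($) v) {..<dim_vec v} = 1"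
    using take take[of "dim_vec v"] by (simp add: alt_from_iff_prefix_sums)
  \<comment> \<open>Cut points beyond the dimension give the whole sum again, so bounded and
    unbounded quantification agree.\<close>
  also have "(\<forall>k \<le> dim_vec v. sum (($) v) {..<k} \<in> {0, 1}) \<longleftrightarrow>
      (\<forall>x. sum (($) v) {y \<in> {..<dim_vec v}. y < x} \<in> {0, 1})"
  proof -
    have "{y \<in> {..<dim_vec v}. y < x} = {..<min x (dim_vec v)}" for x by auto
    then show ?thesis
      by (metis min.cobounded2 min.absorb1)
  qed
  finally show ?thesis by (simp add: alt_on_def)
qed

lemma alt_on_prefix_Suc:
  assumes "finite I" "x \<in> I"
  shows "sum f {y \<in> I. y < Suc x} = sum f {y \<in> I. y < x} + f x"
proof -
  have "{y \<in> I. y < Suc x} = insert x {y \<in> I. y < x}" using assms by auto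
  then show ?thesis using assms by (simp add: add.commute)
qed

text \<open>An entry is the difference of two consecutive partial sums, each of them 0 or 1.\<close>

lemma alt_on_values:
  assumes "alt_on I f" "finite I" "x \<in> I"
  shows "f x \<in> {-1, 0, 1}"
proof -
  have "sum f {y \<in> I. y < Suc x} \<in> {0, 1}" "sum f {y \<in> I. y < x} \<in> {0, 1}"
    using assms(1) unfolding alt_on_def by blast+
  then show ?thesis using alt_on_prefix_Suc[OF assms(2,3), of f] by auto
qed

text \<open>The premise with \<open>=simp=>\<close> makes this usable as a congruence rule: entries
  are rewritten only at positions inside the index set.\<close>

lemma alt_on_cong:
  assumes "I = J" and "\<And>x. x \<in> J =simp=> f x = g x"
  shows "alt_on I f \<longleftrightarrow> alt_on J g"
proof -
  have "sum f {y \<in> I. y < x} = sum g {y \<in> J. y < x}" for x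
    using assms by (intro sum.cong) (auto simp: simp_implies_def)
  moreover have "sum f I = sum g J" using assms by (intro sum.cong) (auto simp: simp_implies_def)
  ultimately show ?thesis by (simp add: alt_on_def)
qed

text \<open>A strictly increasing map carries initial segments to initial segments. The care goes
  into cut points that are not themselves positions.\<close>

lemma alt_on_reindex:
  assumes "finite I" "strict_mono_on I h"
  shows "alt_on I (\<lambda>x. f (h x)) \<longleftrightarrow> alt_on (h ` I) f"
proof -
  have inj: "inj_on h J" if "J \<subseteq> I" for J
    using strict_mono_on_imp_inj_on[OF assms(2)] that inj_on_subset by blast
  have mono: "h y < h x \<longleftrightarrow> y < x" if "x \<in> I" "y \<in> I" for x y
    using strict_mono_on_less[OF assms(2)] that by auto
  have sums: "sum (\<lambda>x. f (h x)) J = sum f (h ` J)" if "J \<subseteq> I" for J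
    using sum.reindex[OF inj[OF that], of f] by (simp add: comp_def)
  have "(\<forall>x. sum f {y \<in> h ` I. y < x} \<in> {0, 1}) \<longleftrightarrow>
    (\<forall>x. sum (\<lambda>x. f (h x)) {y \<in> I. y < x} \<in> {0, 1})"
  proof (intro iffI allI)
    fix x assume *: "\<forall>x. sum f {y \<in> h ` I. y < x} \<in> {0, 1}"
    show "sum (\<lambda>x. f (h x)) {y \<in> I. y < x} \<in> {0, 1}"
    proof (cases "\<exists>z \<in> I. x \<le> z")
      case True
      \<comment> \<open>Moving the cut up to the first position at or above it leaves the initial
        segment unchanged, and a cut at a position can be transported by \<open>h\<close>.\<close>
      define z where "z = (LEAST z. z \<in> I \<and> x \<le> z)"
      have z: "z \<in> I" "x \<le> z" and zmin: "\<And>w. w \<in> I \<Longrightarrow> x \<le> w \<Longrightarrow> z \<le> w"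
        using True LeastI_ex[of "\<lambda>z. z \<in> I \<and> x \<le> z"] unfolding z_def
        by (auto intro!: Least_le)
      have "{y \<in> I. y < x} = {y \<in> I. y < z}" using z zmin by force
      moreover have "h ` {y \<in> I. y < z} = {y \<in> h ` I. y < h z}" using mono z(1) by auto
      ultimately show ?thesis using *[rule_format, of "h z"] sums[of "{y \<in> I. y < z}"] by auto
    next
      case False
      then have 1: "{y \<in> I. y < x} = I" by force
      obtain b where "\<forall>y \<in> h ` I. y < b"
        using assms(1) finite_nat_set_iff_bounded by (metis finite_imageI)
      then have "{y \<in> h ` I. y < b} = h ` I" by auto
      then show ?thesis using *[rule_format, of b] sums[of I] 1 by simp
    qed
  next
    fix x assume *: "\<forall>x. sum (\<lambda>x. f (h x)) {y \<in> I. y < x} \<in> {0, 1}"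
    show "sum f {y \<in> h ` I. y < x} \<in> {0, 1}"
    proof (cases "\<exists>z \<in> I. x \<le> h z")
      case True
      define z where "z = (LEAST z. z \<in> I \<and> x \<le> h z)"
      have z: "z \<in> I" "x \<le> h z" and zmin: "\<And>w. w \<in> I \<Longrightarrow> x \<le> h w \<Longrightarrow> z \<le> w"
        using True LeastI_ex[of "\<lambda>z. z \<in> I \<and> x \<le> h z"] unfolding z_def
        by (auto intro!: Least_le)
      have "h y < x \<longleftrightarrow> y < z" if "y \<in> I" for y
        using mono[OF z(1) that] zmin[OF that] z(2) by force
      then have "h ` {y \<in> I. y < z} = {y \<in> h ` I. y < x}" by auto
      then show ?thesis using *[rule_format, of z] sums[of "{y \<in> I. y < z}"] by auto
    next
      case False
      then have 1: "{y \<in> h ` I. y < x} = h ` I" by force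
      obtain b where "\<forall>y \<in> I. y < b"
        using assms(1) finite_nat_set_iff_bounded by metis
      then have "{y \<in> I. y < b} = I" by auto
      then show ?thesis using *[rule_format, of b] sums[of I] 1 by simp
    qed
  qed
  then show ?thesis using sums[of I] by (simp add: alt_on_def)
qed

lemma alt_on_remove_zeros:
  assumes "finite I" "J \<subseteq> I" "\<And>x. x \<in> I - J \<Longrightarrow> f x = 0"
  shows "alt_on J f \<longleftrightarrow> alt_on I f"
proof -
  have "sum f {y \<in> J. y < x} = sum f {y \<in> I. y < x}" for x
    using assms by (intro sum.mono_neutral_left) auto
  moreover have "sum f J = sum f I"
    using assms by (intro sum.mono_neutral_left) auto
  ultimately show ?thesis by (simp add: alt_on_def)
qed

text \<open>Partial sums up to \<open>a\<close> and beyond \<open>b\<close> do not change. A cut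
  between the two now sees the sum up to \<open>a\<close>, because all entries in between
  vanish.\<close>

lemma alt_on_remove_pair:
  assumes alt: "alt_on I f" and fin: "finite I" and a: "a \<in> I" "b \<in> I" "a < b"
    and opp: "f a + f b = 0" and zero: "\<And>x. x \<in> I \<Longrightarrow> a < x \<Longrightarrow> x < b \<Longrightarrow> f x = 0"
  shows "alt_on (I - {a, b}) f"
  unfolding alt_on_def
proof (intro conjI allI)
  have "sum f I = f a + (f b + sum f (I - {a} - {b}))"
    using fin a by (simp add: sum.remove)
  moreover have "I - {a} - {b} = I - {a, b}" by auto
  ultimately have "sum f I = sum f (I - {a, b})" using opp by simp
  then show "sum f (I - {a, b}) = 1" using alt by (simp add: alt_on_def)
next
  fix x
  consider "x \<le> a" | "a < x" "x \<le> b" | "b < x" by linarith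
  then show "sum f {y \<in> I - {a, b}. y < x} \<in> {0, 1}"
  proof cases
    case 1
    then have "{y \<in> I - {a, b}. y < x} = {y \<in> I. y < x}" using a by auto
    then show ?thesis using alt by (simp add: alt_on_def)
  next
    case 2
    have "sum f {y \<in> I - {a, b}. y < x} = sum f {y \<in> I. y < a}"
      using 2 zero a(3) fin by (intro sum.mono_neutral_right) (auto, metis linorder_neqE_nat less_le_trans)
    then show ?thesis using alt by (simp add: alt_on_def)
  next
    case 3
    let ?S = "{y \<in> I. y < x}"
    have "sum f ?S = f a + (f b + sum f (?S - {a} - {b}))"
      using fin a 3 sum.remove[of ?S a f] sum.remove[of "?S - {a}" b f] by simp
    moreover have "?S - {a} - {b} = {y \<in> I - {a, b}. y < x}" by auto
    ultimately have "sum f ?S = sum f {y \<in> I - {a, b}. y < x}" using opp by simp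
    then show ?thesis using alt by (metis (no_types, lifting) alt_on_def)
  qed
qed

text \<open>The entries on \<open>I\<close> sum to 1, so a later -1 brings the sum to 0 and the
  final +1 restores it.\<close>

lemma alt_on_insert_after:
  assumes alt: "alt_on I f" and fin: "finite I" and a: "a \<notin> I" "b \<notin> I" "a < b"
    and last: "\<And>x. x \<in> I \<Longrightarrow> x < a" and f: "f a = -1" "f b = 1"
  shows "alt_on (I \<union> {a, b}) f"
  unfolding alt_on_def
proof (intro conjI allI)
  have tot: "sum f I = 1" using alt by (simp add: alt_on_def)
  show "sum f (I \<union> {a, b}) = 1" using fin a f tot by simp
  fix x
  consider "x \<le> a" | "a < x" "x \<le> b" | "b < x" by linarith
  then show "sum f {y \<in> I \<union> {a, b}. y < x} \<in> {0, 1}"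
  proof cases
    case 1
    then have "{y \<in> I \<union> {a, b}. y < x} = {y \<in> I. y < x}" using a by auto
    then show ?thesis using alt by (simp add: alt_on_def)
  next
    case 2
    then have "{y \<in> I \<union> {a, b}. y < x} = insert a I" using last by force
    then show ?thesis using fin a f tot by simp
  next
    case 3
    then have "{y \<in> I \<union> {a, b}. y < x} = insert a (insert b I)" using last a(3) by force
    then show ?thesis using fin a f tot by simp
  qed
qed

lemma alt_on_singleton: "f a = 1 \<Longrightarrow> alt_on {a} f"
proof -
  assume "f a = 1"
  moreover have "{y \<in> {a}. y < x} = (if a < x then {a} else {})" for x by auto
  ultimately show ?thesis by (simp add: alt_on_def)
qed

lemma alt_on_triple:
  assumes "a < b" "b < c" "f a = 1" "f b = -1" "f c = 1"
  shows "alt_on {a, b, c} f"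
proof -
  have "alt_on ({a} \<union> {b, c}) f"
    using assms by (intro alt_on_insert_after alt_on_singleton) auto
  then show ?thesis unfolding insert_is_Un[of a "{b, c}"] .
qed

text \<open>At a -1 the partial sum must drop from 1 to 0. So something nonzero precedes it, and as
  the total is 1, something nonzero follows. The nearest nonzero entries on both sides are +1, since
  a -1 there would push a partial sum out of {0, 1}.\<close>

lemma alt_on_negative_neighbours:
  assumes alt: "alt_on I f" and fin: "finite I" and p: "p \<in> I" "f p = -1"
  obtains q s where "q \<in> I" "s \<in> I" "q < p" "p < s" "f q = 1" "f s = 1"
    "\<And>x. x \<in> I \<Longrightarrow> q < x \<Longrightarrow> x < s \<Longrightarrow> x \<noteq> p \<Longrightarrow> f x = 0"
proof -
  have pre: "sum f {y \<in> I. y < x} \<in> {0, 1}" for x using alt by (simp add: alt_on_def)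
  have tot: "sum f I = 1" using alt by (simp add: alt_on_def)
  have before: "sum f {y \<in> I. y < p} = 1" and upto: "sum f {y \<in> I. y < Suc p} = 0"
    using pre[of p] pre[of "Suc p"] alt_on_prefix_Suc[OF fin p(1), of f] p(2) by auto
  let ?Q = "{y \<in> I. y < p \<and> f y \<noteq> 0}"
  let ?S = "{y \<in> I. p < y \<and> f y \<noteq> 0}"
  have Q: "?Q \<noteq> {}"
  proof
    assume e: "?Q = {}"
    have "sum f {y \<in> I. y < p} = 0" by (rule sum.neutral) (use e in blast)
    then show False using before by simp
  qed
  have S: "?S \<noteq> {}"
  proof
    assume e: "?S = {}"
    have "sum f I = sum f {y \<in> I. y < Suc p}"
      using fin e by (intro sum.mono_neutral_right) (auto simp: less_Suc_eq_le not_le[symmetric])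
    then show False using upto tot by simp
  qed
  define q where "q = Max ?Q"
  define s where "s = Min ?S"
  have q: "q \<in> I" "q < p" "f q \<noteq> 0" using Max_in[OF _ Q] fin unfolding q_def by auto
  have s: "s \<in> I" "p < s" "f s \<noteq> 0" using Min_in[OF _ S] fin unfolding s_def by auto
  have qz: "f x = 0" if "x \<in> I" "q < x" "x < p" for x
    using Max_ge[of ?Q x] that fin unfolding q_def by (fastforce simp: not_le[symmetric])
  have sz: "f x = 0" if "x \<in> I" "p < x" "x < s" for x
    using Min_le[of ?S x] that fin unfolding s_def by (fastforce simp: not_le[symmetric])
  have "sum f {y \<in> I. y < p} = sum f {y \<in> I. y < Suc q}"
    using fin qz q by (intro sum.mono_neutral_right) (auto simp: less_Suc_eq_le not_le[symmetric])
  then have "f q = 1"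
    using before alt_on_prefix_Suc[OF fin q(1), of f] pre[of q] q(3) by auto
  moreover have "sum f {y \<in> I. y < s} = sum f {y \<in> I. y < Suc p}"
    using fin sz s by (intro sum.mono_neutral_right) (auto simp: less_Suc_eq_le not_le[symmetric])
  then have "f s = 1"
    using upto alt_on_prefix_Suc[OF fin s(1), of f] pre[of "Suc s"] s(3) by auto
  ultimately show thesis using that[of q s] q s qz sz by (metis linorder_neqE_nat)
qed

lemma is_asm_iff_alt_on:
  assumes "A \<in> carrier_mat n n"
  shows "is_asm A \<longleftrightarrow> (\<forall>i<n. alt_on {..<n} (\<lambda>j. A $$ (i, j))) \<and>
    (\<forall>j<n. alt_on {..<n} (\<lambda>i. A $$ (i, j)))"
proof -
  have d: "dim_row A = n" "dim_col A = n" using assms by auto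
  have r: "alternating (row A i) \<longleftrightarrow> alt_on {..<n} (\<lambda>j. A $$ (i, j))" if "i < n" for i
    unfolding alternating_iff_alt_on using that d by (simp cong: alt_on_cong)
  have c: "alternating (col A j) \<longleftrightarrow> alt_on {..<n} (\<lambda>i. A $$ (i, j))" if "j < n" for j
    unfolding alternating_iff_alt_on using that d by (simp cong: alt_on_cong)
  have "elements_mat A \<subseteq> {0, 1, -1}" if "\<forall>i<n. alt_on {..<n} (\<lambda>j. A $$ (i, j))"
    using that alt_on_values d unfolding elements_mat_def by fastforce
  then show ?thesis using r c d by (auto simp: is_asm_def square_mat.simps)
qed

section \<open>Attaching and removing D3\<close>

text \<open>
  Connectedness of \<open>BG A\<close> without paths: \<open>P\<close> and \<open>Q\<close> are the row and column parts of a vertex set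
  that no edge leaves.
\<close>

definition cut_connected :: "nat \<Rightarrow> int mat \<Rightarrow> bool" where
  "cut_connected n A \<longleftrightarrow>
     (\<forall>P Q :: nat \<Rightarrow> bool. (\<forall>i<n. \<forall>j<n. A $$ (i, j) \<noteq> 0 \<longrightarrow> P i = Q j) \<longrightarrow>
     (\<exists>b. \<forall>i<n. P i = b \<and> Q i = b))"

lemma cut_connectedD:
  fixes P Q :: "nat \<Rightarrow> bool"
  assumes "cut_connected n A" "\<And>i j. i < n \<Longrightarrow> j < n \<Longrightarrow> A $$ (i, j) \<noteq> 0 \<Longrightarrow> P i = Q j"
  obtains b where "\<And>i. i < n \<Longrightarrow> P i = b" "\<And>i. i < n \<Longrightarrow> Q i = b"
proof -
  have "\<exists>b. \<forall>i<n. P i = b \<and> Q i = b"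
    using assms(1)[unfolded cut_connected_def, THEN spec, THEN spec, of P Q] assms(2) by simp
  then show thesis using that by blast
qed

lemma asm_entry:
  assumes "is_asm A" "A \<in> carrier_mat n n" "i < n" "j < n"
  shows "A $$ (i, j) \<in> {-1, 0, 1}"
  using assms alt_on_values[of "{..<n}" "\<lambda>j. A $$ (i, j)" j] by (simp add: is_asm_iff_alt_on)

text \<open>A path cannot leave a vertex set that no edge leaves; conversely, the vertices reachable
  from a given one form such a set.\<close>

lemma connected_BG_iff_cut_connected:
  assumes A: "A \<in> carrier_mat n n" "is_asm A" and n: "0 < n"
  shows "connected (with_proj (underlying (BG A))) \<longleftrightarrow> cut_connected n A"
proof -
  let ?G = "underlying (BG A)"
  let ?S = "with_proj (mk_symmetric (with_proj ?G))"
  have d: "dim_row A = n" "dim_col A = n" using A by auto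
  have verts: "pverts ?G = Row ` {..<n} \<union> Col ` {..<n}"
    by (simp add: underlying_def BG_def d)
  \<comment> \<open>\<open>underlying\<close> already holds both orientations of each edge, so the
    symmetric closure in the definition of \<open>connected\<close> adds nothing.\<close>
  have arcs: "parcs (mk_symmetric (with_proj ?G)) =
     {(Row i, Col j) | i j. i < n \<and> j < n \<and> A $$ (i, j) \<noteq> 0} \<union>
     {(Col j, Row i) | i j. i < n \<and> j < n \<and> A $$ (i, j) \<noteq> 0}" (is "_ = ?E")
  proof -
    have "parcs ?G = ?E"
      using asm_entry[OF A(2,1), simplified]
      by (fastforce simp: underlying_def BG_def d doubleton_eq_iff)
    then have "parcs (mk_symmetric (with_proj ?G)) = (\<Union>e\<in>?E. {e, prod.swap e})"
      by (simp add: parcs_mk_symmetric prod.swap_def)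
    also have "\<dots> = ?E"
    proof -
      have "prod.swap e \<in> ?E" if "e \<in> ?E" for e using that by auto
      then show ?thesis by (intro equalityI UN_least subsetI) (blast | simp)+
    qed
    finally show ?thesis .
  qed
  show ?thesis
  proof
    assume conn: "connected (with_proj ?G)"
    show "cut_connected n A"
      unfolding cut_connected_def
    proof (intro allI impI)
      fix P Q :: "nat \<Rightarrow> bool" assume PQ: "\<forall>i<n. \<forall>j<n. A $$ (i, j) \<noteq> 0 \<longrightarrow> P i = Q j"
      define S where "S v = (case v of Row i \<Rightarrow> P i | Col j \<Rightarrow> Q j)" for v
      have "S v = P 0" if "v \<in> pverts ?G" for v
      proof -
        have "Row 0 \<rightarrow>\<^sup>*\<^bsub>?S\<^esub> v"
          using conn that n verts by (auto simp: connected_def strongly_connected_def)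
        then have "(Row 0, v) \<in> rtrancl_on (pverts ?G) ?E"
          by (simp add: reachable_def arcs)
        then show ?thesis
          by (induction rule: rtrancl_on_induct) (use PQ in \<open>auto simp: S_def\<close>)
      qed
      then show "\<exists>b. \<forall>i<n. P i = b \<and> Q i = b"
        by (metis (no_types, lifting) S_def UnI1 UnI2 bg_vertex.simps(5,6) imageI lessThan_iff verts)
    qed
  next
    assume cut: "cut_connected n A"
    have "(u, v) \<in> rtrancl_on (pverts ?G) ?E" if uv: "u \<in> pverts ?G" "v \<in> pverts ?G" for u v
    proof -
      \<comment> \<open>No edge leaves the set of vertices reachable from \<open>u\<close>, and it
        contains \<open>u\<close>; the cut property therefore makes it everything.\<close>
      define R where "R v \<longleftrightarrow> (u, v) \<in> rtrancl_on (pverts ?G) ?E" for v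
      have step: "R y" if "R x" "(x, y) \<in> ?E" for x y
        using that rtrancl_on_into_rtrancl_on[of u x "pverts ?G" ?E y] verts unfolding R_def by blast
      have "R (Row i) = R (Col j)" if "i < n" "j < n" "A $$ (i, j) \<noteq> 0" for i j
        using step[of "Row i" "Col j"] step[of "Col j" "Row i"] that by blast
      then obtain b where b: "\<And>i. i < n \<Longrightarrow> R (Row i) = b" "\<And>i. i < n \<Longrightarrow> R (Col i) = b"
        using cut_connectedD[OF cut, of "\<lambda>i. R (Row i)" "\<lambda>j. R (Col j)"] by blast
      have "R u" using uv(1) unfolding R_def by blast
      then show ?thesis using uv b unfolding verts R_def by auto
    qed
    then show "connected (with_proj ?G)"
      using n verts by (auto simp: connected_def strongly_connected_def reachable_def arcs)
  qed
qed

lemma connected_asm_iff: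
  assumes "A \<in> carrier_mat n n" "0 < n"
  shows "connected_asm A \<longleftrightarrow> is_asm A \<and> cut_connected n A"
  using assms connected_BG_iff_cut_connected by (auto simp: connected_asm_def)

section \<open>The effect of attaching \<open>D3\<close> on the number of nonzero entries\<close>

lemma D3_entries:
  "D3 \<in> carrier_mat 3 3"
  "k < 3 \<Longrightarrow> l < 3 \<Longrightarrow> D3 $$ (k, l) = (if k = 1 \<and> l = 1 then -1 else if k = 1 \<or> l = 1 then 1 else 0)"
proof -
  show car: "D3 \<in> carrier_mat 3 3" 
    by (intro carrier_matI) (simp_all add: D3_def mat_of_rows_list_def)
  assume kl: "k < 3" "l < 3"
  have "D3 $$ (k, l) = [[0, 1, 0], [1, -1, 1], [0, 1, 0]] ! k ! l"
    using kl by (simp add: D3_def mat_of_rows_list_def)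
  moreover have "k = 0 \<or> k = 1 \<or> k = 2" "l = 0 \<or> l = 1 \<or> l = 2" using kl by linarith+
  ultimately show "D3 $$ (k, l) = (if k = 1 \<and> l = 1 then -1 else if k = 1 \<or> l = 1 then 1 else 0)"
    by (elim disjE) (simp_all add: numeral_2_eq_2)
qed

text \<open>\<open>D3\<close> has five nonzero entries, one of which is the old entry at which it is
  attached; the other four are new.\<close>

lemma attaches_D3_at_num_nonzero:
  assumes "attaches_D3_at n A i j B"
  shows "num_nonzero B = num_nonzero A + 4"
proof -
  from assms obtain f g \<rho> \<gamma> p q where A: "A \<in> carrier_mat n n" and B: "B \<in> carrier_mat (n + 2) (n + 2)"
    and f: "strict_mono_on {..<n} f" "f ` {..<n} \<subseteq> {..<n + 2}"
    and g: "strict_mono_on {..<n} g" "g ` {..<n} \<subseteq> {..<n + 2}"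
    and BA: "\<forall>k < n. \<forall>l < n. B $$ (f k, g l) = A $$ (k, l)"
    and \<rho>: "strict_mono_on {..<3::nat} \<rho>" "\<rho> ` {..<3} \<subseteq> {..<n + 2}"
    and \<gamma>: "strict_mono_on {..<3::nat} \<gamma>" "\<gamma> ` {..<3} \<subseteq> {..<n + 2}"
    and D: "mat 3 3 (\<lambda>(k, l). B $$ (\<rho> k, \<gamma> l)) = D3"
    and pq: "p < 3" "q < 3" "D3 $$ (p, q) = 1"
    and newf: "{..<n + 2} - f ` {..<n} = \<rho> ` ({..<3} - {p})"
    and newg: "{..<n + 2} - g ` {..<n} = \<gamma> ` ({..<3} - {q})"
    and rest: "\<forall>k < n + 2. \<forall>l < n + 2.
           (k \<notin> f ` {..<n} \<or> l \<notin> g ` {..<n}) \<and> \<not> (k \<in> \<rho> ` {..<3} \<and> l \<in> \<gamma> ` {..<3})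
           \<longrightarrow> B $$ (k, l) = 0"
    and ij: "i < n" "j < n" "f i = \<rho> p" "g j = \<gamma> q"
    unfolding attaches_D3_at_def by (elim conjE exE) (rule that)
  have BD: "B $$ (\<rho> k, \<gamma> l) = D3 $$ (k, l)" if "k < 3" "l < 3" for k l
    using arg_cong[OF D, of "\<lambda>M. M $$ (k, l)"] that by simp
  let ?Z = "\<lambda>A::int mat. {(i, j). i < dim_row A \<and> j < dim_col A \<and> A $$ (i, j) \<noteq> 0}"
  let ?ZD = "{(0, 1), (1, 0), (1, 1), (1, 2), (2, 1)} :: (nat \<times> nat) set"
  have ZD: "(k, l) \<in> ?ZD \<longleftrightarrow> k < 3 \<and> l < 3 \<and> D3 $$ (k, l) \<noteq> 0" for k l
  proof (cases "k < 3 \<and> l < 3")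
    case True
    moreover from this have "k = 0 \<or> k = 1 \<or> k = 2" "l = 0 \<or> l = 1 \<or> l = 2" by linarith+
    ultimately show ?thesis by (elim disjE) (simp_all add: D3_entries)
  qed auto
  have new_row: "\<rho> a \<notin> f ` {..<n}" if "a < 3" "a \<noteq> p" for a
    using newf that by blast
  have new_col: "\<gamma> b \<notin> g ` {..<n}" if "b < 3" "b \<noteq> q" for b
    using newg that by blast
  \<comment> \<open>A position of \<open>D3\<close> other than \<open>(p, q)\<close> lies in a new
    row or a new column, so it is not the image of a position of \<open>A\<close>.\<close>
  have disj: "map_prod f g ` ?Z A \<inter> map_prod \<rho> \<gamma> ` (?ZD - {(p, q)}) = {}"
  proof -
    have 1: "\<rho> a \<notin> f ` {..<n} \<or> \<gamma> b \<notin> g ` {..<n}" if "(a, b) \<in> ?ZD - {(p, q)}" for a b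
      using that new_row[of a] new_col[of b] ZD[of a b] by (metis Diff_iff insertCI)
    have 2: "f k \<in> f ` {..<n} \<and> g l \<in> g ` {..<n}" if "(k, l) \<in> ?Z A" for k l
      using that A by auto
    have "(f k, g l) \<noteq> (\<rho> a, \<gamma> b)" if "(k, l) \<in> ?Z A" "(a, b) \<in> ?ZD - {(p, q)}" for k l a b
      using 1[OF that(2)] 2[OF that(1)] by auto
    moreover have "map_prod f g ` X \<inter> map_prod \<rho> \<gamma> ` Y = {}"
      if "\<And>k l a b. (k, l) \<in> X \<Longrightarrow> (a, b) \<in> Y \<Longrightarrow> (f k, g l) \<noteq> (\<rho> a, \<gamma> b)" for X Y
      using that by (auto simp: disjoint_iff)
    ultimately show ?thesis by blast
  qed
  have "?Z B = map_prod f g ` ?Z A \<union> map_prod \<rho> \<gamma> ` (?ZD - {(p, q)})" (is "_ = ?X \<union> ?Y")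
  proof (intro equalityI subsetI)
    fix x assume "x \<in> ?Z B"
    then obtain k l where x: "x = (k, l)" and kl: "k < n + 2" "l < n + 2" "B $$ (k, l) \<noteq> 0"
      using B by auto
    show "x \<in> ?X \<union> ?Y"
    proof (cases "k \<in> f ` {..<n} \<and> l \<in> g ` {..<n}")
      case True
      then obtain k' l' where "k' < n" "l' < n" "k = f k'" "l = g l'" by auto
      then have "(k', l') \<in> ?Z A" "x = map_prod f g (k', l')" using BA kl x A by auto
      then show ?thesis by blast
    next
      case False
      then obtain a b where ab: "a < 3" "b < 3" "k = \<rho> a" "l = \<gamma> b"
        using rest kl by blast
      then have "(a, b) \<in> ?ZD" using ZD BD kl by auto
      moreover have "(a, b) \<noteq> (p, q)" using False ab ij by (metis imageI lessThan_iff prod.inject)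
      ultimately show ?thesis using ab x by force
    qed
  next
    fix x assume "x \<in> ?X \<union> ?Y"
    then show "x \<in> ?Z B"
    proof
      assume "x \<in> ?X"
      then obtain k l where kl: "(k, l) \<in> ?Z A" "x = (f k, g l)" by auto
      then have lt: "k < n" "l < n" using A by auto
      then have "f k < n + 2" "g l < n + 2" using f(2) g(2) by blast+
      then show ?thesis using kl lt B BA by simp
    next
      assume "x \<in> ?Y"
      then obtain a b where ab: "(a, b) \<in> ?ZD" "x = (\<rho> a, \<gamma> b)" by (elim imageE DiffE) (metis map_prod_simp surj_pair)
      then have lt: "a < 3" "b < 3" "D3 $$ (a, b) \<noteq> 0"
        using ZD[THEN iffD1, OF ab(1)] by simp_all
      then have "\<rho> a < n + 2" "\<gamma> b < n + 2" using \<rho>(2) \<gamma>(2) by blast+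
      then show ?thesis using lt BD ab B by simp
    qed
  qed
  moreover have "card ?X = card (?Z A)"
  proof (rule card_image)
    have "inj_on f {..<n}" "inj_on g {..<n}" using f g strict_mono_on_imp_inj_on by auto
    then have "inj_on (map_prod f g) ({..<n} \<times> {..<n})" by (rule map_prod_inj_on)
    then show "inj_on (map_prod f g) (?Z A)" by (rule inj_on_subset) (use A in auto)
  qed
  moreover have "card ?Y = card (?ZD - {(p, q)})"
  proof (rule card_image)
    have "inj_on \<rho> {..<3}" "inj_on \<gamma> {..<3}" using \<rho> \<gamma> strict_mono_on_imp_inj_on by auto
    then have "inj_on (map_prod \<rho> \<gamma>) ({..<3} \<times> {..<3})" by (rule map_prod_inj_on)
    then show "inj_on (map_prod \<rho> \<gamma>) (?ZD - {(p, q)})" by (rule inj_on_subset) auto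
  qed
  moreover have "card (?ZD - {(p, q)}) = 4"
  proof -
    have "(p, q) \<in> ?ZD" using ZD pq by simp
    then show ?thesis by (simp add: card_Diff_singleton)
  qed
  moreover have "finite (?Z A)" by (rule finite_subset[of _ "{..<dim_row A} \<times> {..<dim_col A}"]) auto
  ultimately show ?thesis
    unfolding num_nonzero_def using disj by (simp add: card_Un_disjoint)
qed

lemma attaches_D3E:
  assumes "attaches_D3 A B"
  obtains m where "0 < m" "A \<in> carrier_mat m m" "B \<in> carrier_mat (m + 2) (m + 2)"
    "is_asm A" "is_asm B" "num_nonzero B = num_nonzero A + 4"
proof -
  obtain m i j where at: "attaches_D3_at m A i j B" using assms unfolding attaches_D3_def by blast
  then have "i < m" "A \<in> carrier_mat m m" "B \<in> carrier_mat (m + 2) (m + 2)" "is_asm A" "is_asm B"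
    unfolding attaches_D3_at_def by blast+
  then show thesis using that[of m] attaches_D3_at_num_nonzero[OF at] by simp
qed

section \<open>Deleting a copy of \<open>D3\<close>\<close>

lemma ex_strict_mono_enumeration:
  fixes F :: "nat set"
  assumes "finite F"
  obtains h where "strict_mono_on {..<card F} h" "h ` {..<card F} = F"
proof -
  let ?l = "sorted_list_of_set F"
  have len: "length ?l = card F" by simp
  have "strict_mono_on {..<card F} (\<lambda>k. ?l ! k)"
    using sorted_wrt_nth_less[OF strict_sorted_list_of_set] len
    by (auto intro!: strict_mono_onI)
  moreover have "(\<lambda>k. ?l ! k) ` {..<card F} = F"
    using assms len nth_image[of "card F" ?l] by (simp add: lessThan_atLeast0)
  ultimately show thesis by (rule that)
qed

text \<open>
  Row \<open>q\<close> and column \<open>c\<close> carry the entry that stays; rows \<open>r\<close>, \<open>s\<close> and columns \<open>\<gamma>1\<close>, \<open>\<gamma>3\<close> are deleted.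
\<close>

lemma remove_D3:
  fixes A :: "int mat"
  assumes A: "A \<in> carrier_mat n n" "is_asm A" and conn: "cut_connected n A"
    and lt: "r < n" "q < n" "s < n" "\<gamma>1 < c" "c < \<gamma>3" "\<gamma>3 < n"
    and order: "q < r \<and> r < s \<or> s < r \<and> r < q"
    and centre: "A $$ (r, c) = -1"
    and ones: "A $$ (r, \<gamma>1) = 1" "A $$ (r, \<gamma>3) = 1" "A $$ (q, c) = 1" "A $$ (s, c) = 1"
    and row_r: "\<And>l. l < n \<Longrightarrow> l \<notin> {\<gamma>1, c, \<gamma>3} \<Longrightarrow> A $$ (r, l) = 0"
    and leaf_cols: "\<And>k. k < n \<Longrightarrow> k \<noteq> r \<Longrightarrow> A $$ (k, \<gamma>1) = 0 \<and> A $$ (k, \<gamma>3) = 0"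
    and leaf_row: "\<And>l. l < n \<Longrightarrow> l \<noteq> c \<Longrightarrow> A $$ (s, l) = 0"
    and between: "\<And>k. k < n \<Longrightarrow> min r s < k \<Longrightarrow> k < max r s \<Longrightarrow> A $$ (k, c) = 0"
  shows "\<exists>A'. attaches_D3 A' A \<and> cut_connected (n - 2) A'"
proof -
  define F where "F = {..<n} - {r, s}"
  define G where "G = {..<n} - {\<gamma>1, \<gamma>3}"
  have rs: "r \<noteq> s" "q \<noteq> r" "q \<noteq> s" using order by auto
  have n2: "n = (n - 2) + 2" using lt rs by linarith
  have cF: "card F = n - 2" using lt rs by (simp add: F_def card_Diff_subset)
  have cG: "card G = n - 2" using lt by (simp add: G_def card_Diff_subset)
  obtain f where f: "strict_mono_on {..<n - 2} f" "f ` {..<n - 2} = F"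
    using ex_strict_mono_enumeration[of F] cF unfolding F_def by auto
  obtain g where g: "strict_mono_on {..<n - 2} g" "g ` {..<n - 2} = G"
    using ex_strict_mono_enumeration[of G] cG unfolding G_def by auto
  have fF: "f k \<in> F" if "k < n - 2" for k using f(2) that by blast
  have gG: "g k \<in> G" if "k < n - 2" for k using g(2) that by blast
  have inj: "inj_on f {..<n - 2}" "inj_on g {..<n - 2}"
    using f(1) g(1) strict_mono_on_imp_inj_on by auto
  have row_s: "A $$ (s, l) = 0" if "l < n" "l \<noteq> c" for l using leaf_row that by blast
  define A' where "A' = mat (n - 2) (n - 2) (\<lambda>(k, l). A $$ (f k, g l))"
  have A': "A' \<in> carrier_mat (n - 2) (n - 2)" by (simp add: A'_def)
  have entry: "A' $$ (k, l) = A $$ (f k, g l)" if "k < n - 2" "l < n - 2" for k l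
    using that by (simp add: A'_def)
  \<comment> \<open>Every surviving row and column loses only zeros, except column \<open>c\<close>:
    it loses the -1 in row \<open>r\<close> and the +1 in row \<open>s\<close>, which have only
    zeros between them.\<close>
  have asm: "is_asm A'"
    unfolding is_asm_iff_alt_on[OF A']
  proof (intro conjI allI impI)
    fix k assume k: "k < n - 2"
    have "alt_on {..<n} (\<lambda>l. A $$ (f k, l))"
      using A fF[OF k] by (simp add: is_asm_iff_alt_on F_def)
    then have "alt_on G (\<lambda>l. A $$ (f k, l))"
      using fF[OF k] leaf_cols
      by (subst alt_on_remove_zeros[of "{..<n}"]) (auto simp: G_def F_def)
    then have "alt_on {..<n - 2} (\<lambda>l. A $$ (f k, g l))"
      using alt_on_reindex[of "{..<n - 2}" g "\<lambda>l. A $$ (f k, l)"] g by simp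
    then show "alt_on {..<n - 2} (\<lambda>l. A' $$ (k, l))"
      using entry k by (simp cong: alt_on_cong)
  next
    fix l assume l: "l < n - 2"
    have col: "alt_on {..<n} (\<lambda>k. A $$ (k, g l))"
      using A gG[OF l] by (simp add: is_asm_iff_alt_on G_def)
    have "alt_on F (\<lambda>k. A $$ (k, g l))"
    proof (cases "g l = c")
      case True
      have eq: "{..<n} - {min r s, max r s} = F" by (auto simp: F_def min_def max_def)
      show ?thesis
        unfolding eq[symmetric]
        by (rule alt_on_remove_pair[OF col])
          (use True rs lt centre ones between in \<open>auto simp: min_def max_def\<close>)
    next
      case False
      then have "A $$ (r, g l) = 0" "A $$ (s, g l) = 0"
        using gG[OF l] row_r row_s by (auto simp: G_def)
      then show ?thesis
        using col by (subst alt_on_remove_zeros[of "{..<n}"]) (auto simp: F_def)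
    qed
    then have "alt_on {..<n - 2} (\<lambda>k. A $$ (f k, g l))"
      using alt_on_reindex[of "{..<n - 2}" f "\<lambda>k. A $$ (k, g l)"] f by simp
    then show "alt_on {..<n - 2} (\<lambda>k. A' $$ (k, l))"
      using entry l by (simp cong: alt_on_cong)
  qed
  have "q \<in> F" "c \<in> G" using lt rs by (auto simp: F_def G_def)
  then obtain i j where ij: "i < n - 2" "f i = q" "j < n - 2" "g j = c"
    unfolding f(2)[symmetric] g(2)[symmetric] by auto
  \<comment> \<open>Row \<open>r\<close> carries the centre and takes position 1. The test
    \<open>(k = 0) = (q < r)\<close> puts the surviving row \<open>q\<close> first or last,
    according to the two admissible orders.\<close>
  define \<rho> where "\<rho> k = (if k = 1 then r else if (k = 0) = (q < r) then q else s)" for k :: nat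
  define \<gamma> where "\<gamma> k = (if k = 0 then \<gamma>1 else if k = 1 then c else \<gamma>3)" for k :: nat
  define p :: nat where "p = (if q < r then 0 else 2)"
  have three: "{..<3::nat} = {0, 1, 2}" by auto
  have \<rho>im: "\<rho> ` {..<3} = {q, r, s}" using order by (auto simp: \<rho>_def three)
  have \<gamma>im: "\<gamma> ` {..<3} = {\<gamma>1, c, \<gamma>3}" by (auto simp: \<gamma>_def three)
  have "attaches_D3_at (n - 2) A' i j A"
    unfolding attaches_D3_at_def
  proof (intro conjI exI)
    show "A' \<in> carrier_mat (n - 2) (n - 2)" "is_asm A'" "is_asm A" "i < n - 2" "j < n - 2"
      by fact+
    show "A' $$ (i, j) = 1" using entry ij ones by simp
    show "A \<in> carrier_mat (n - 2 + 2) (n - 2 + 2)" using A n2 by simp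
    show "strict_mono_on {..<n - 2} f" "strict_mono_on {..<n - 2} g" by fact+
    show "f ` {..<n - 2} \<subseteq> {..<n - 2 + 2}" "g ` {..<n - 2} \<subseteq> {..<n - 2 + 2}"
      unfolding f(2) g(2) n2[symmetric] by (auto simp: F_def G_def)
    show "\<forall>k<n - 2. \<forall>l<n - 2. A $$ (f k, g l) = A' $$ (k, l)" using entry by simp
    show "strict_mono_on {..<3} \<rho>" "strict_mono_on {..<3} \<gamma>"
      using order lt by (auto simp: three \<rho>_def \<gamma>_def intro!: strict_mono_onI)
    show "\<rho> ` {..<3} \<subseteq> {..<n - 2 + 2}" "\<gamma> ` {..<3} \<subseteq> {..<n - 2 + 2}"
      unfolding \<rho>im \<gamma>im n2[symmetric] using lt by auto
    show "mat 3 3 (\<lambda>(k, l). A $$ (\<rho> k, \<gamma> l)) = D3"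
    proof (rule eq_matI)
      fix k l assume "k < dim_row D3" "l < dim_col D3"
      then have kl: "k \<in> {0, 1, 2}" "l \<in> {0, 1, 2}" using D3_entries(1) by auto
      then have kl': "k < 3" "l < 3" by auto
      show "mat 3 3 (\<lambda>(k, l). A $$ (\<rho> k, \<gamma> l)) $$ (k, l) = D3 $$ (k, l)"
        unfolding D3_entries(2)[OF kl'] index_mat(1)[OF kl'] prod.case
        using kl lt rs leaf_cols[OF lt(2)] leaf_cols[OF lt(3)] ones centre
        by (elim insertE emptyE) (simp_all add: \<rho>_def \<gamma>_def)
    qed (use D3_entries(1) in auto)
    show "p < 3" by (simp add: p_def)
    show "(1::nat) < 3" by simp
    show "D3 $$ (p, 1) = 1" by (simp add: D3_entries p_def)
    show "f i = \<rho> p" "g j = \<gamma> 1" using ij order by (auto simp: \<rho>_def \<gamma>_def p_def)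
    show "{..<n - 2 + 2} - f ` {..<n - 2} = \<rho> ` ({..<3} - {p})"
      unfolding f(2) n2[symmetric] using lt order by (auto simp: F_def three p_def \<rho>_def)
    show "{..<n - 2 + 2} - g ` {..<n - 2} = \<gamma> ` ({..<3} - {1})"
    proof -
      have "{..<3} - {1} = {0, 2::nat}" by auto
      then have "\<gamma> ` ({..<3} - {1}) = {\<gamma>1, \<gamma>3}" by (auto simp: \<gamma>_def)
      then show ?thesis unfolding g(2) n2[symmetric] using lt by (auto simp: G_def)
    qed
    show "\<forall>k<n - 2 + 2. \<forall>l<n - 2 + 2.
        (k \<notin> f ` {..<n - 2} \<or> l \<notin> g ` {..<n - 2}) \<and> \<not> (k \<in> \<rho> ` {..<3} \<and> l \<in> \<gamma> ` {..<3}) \<longrightarrow>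
        A $$ (k, l) = 0"
      unfolding f(2) g(2) \<rho>im \<gamma>im n2[symmetric]
    proof (intro allI impI, elim conjE)
      fix k l assume kl: "k < n" "l < n" "k \<notin> F \<or> l \<notin> G" "\<not> (k \<in> {q, r, s} \<and> l \<in> {\<gamma>1, c, \<gamma>3})"
      then consider "k \<in> {r, s}" "l \<notin> {\<gamma>1, c, \<gamma>3}" | "l \<in> {\<gamma>1, \<gamma>3}" "k \<noteq> r"
        unfolding F_def G_def by blast
      then show "A $$ (k, l) = 0"
        using row_r[OF kl(2)] row_s[OF kl(2)] leaf_cols[OF kl(1)] by cases auto
    qed
  qed
  moreover have "cut_connected (n - 2) A'"
    unfolding cut_connected_def
  proof (intro allI impI)
    fix P Q :: "nat \<Rightarrow> bool" assume PQ: "\<forall>k<n - 2. \<forall>l<n - 2. A' $$ (k, l) \<noteq> 0 \<longrightarrow> P k = Q l"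
    \<comment> \<open>The deleted lines hang on column \<open>c\<close>, directly or through row
      \<open>r\<close>, so a cut of \<open>A'\<close> extends to them only by the value at
      \<open>c\<close>, which is \<open>Q j\<close>.\<close>
    define P' where "P' k = (if k \<in> F then P (the_inv_into {..<n - 2} f k) else Q j)" for k
    define Q' where "Q' k = (if k \<in> G then Q (the_inv_into {..<n - 2} g k) else Q j)" for k
    have P': "P' (f k) = P k" if "k < n - 2" for k
      using that fF inj by (simp add: P'_def the_inv_into_f_f)
    have Q': "Q' (g k) = Q k" if "k < n - 2" for k
      using that gG inj by (simp add: Q'_def the_inv_into_f_f)
    have new: "P' r = Q j" "P' s = Q j" "Q' \<gamma>1 = Q j" "Q' \<gamma>3 = Q j" "Q' c = Q j"
      using Q'[of j] ij by (auto simp: P'_def Q'_def F_def G_def)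
    have closed: "P' k = Q' l" if kl: "k < n" "l < n" "A $$ (k, l) \<noteq> 0" for k l
    proof (cases "k \<in> F \<and> l \<in> G")
      case True
      then obtain k' l' where "k' < n - 2" "l' < n - 2" "k = f k'" "l = g l'"
        unfolding f(2)[symmetric] g(2)[symmetric] by auto
      then show ?thesis using PQ entry kl P' Q' by simp
    next
      case False
      then have "k = r \<or> k = s \<or> l = \<gamma>1 \<or> l = \<gamma>3" using kl by (auto simp: F_def G_def)
      then show ?thesis using kl new row_r row_s leaf_cols by (metis insert_iff empty_iff)
    qed
    then obtain b where b: "\<And>k. k < n \<Longrightarrow> P' k = b" "\<And>k. k < n \<Longrightarrow> Q' k = b"
      using cut_connectedD[OF conn, of P' Q'] by blast
    then show "\<exists>b. \<forall>i<n - 2. P i = b \<and> Q i = b"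
      using P' Q' fF gG unfolding F_def G_def by (metis Diff_iff lessThan_iff)
  qed
  ultimately show ?thesis unfolding attaches_D3_def by blast
qed

section \<open>Transposition\<close>

lemma is_asm_transpose:
  assumes "A \<in> carrier_mat n n"
  shows "is_asm (transpose_mat A) \<longleftrightarrow> is_asm A"
proof -
  have At: "transpose_mat A \<in> carrier_mat n n" using assms by simp
  have "transpose_mat A $$ (i, j) = A $$ (j, i)" if "i < n" "j < n" for i j
    using that assms by auto
  then show ?thesis
    unfolding is_asm_iff_alt_on[OF assms] is_asm_iff_alt_on[OF At] by (auto cong: alt_on_cong)
qed

lemma cut_connected_transpose:
  assumes "A \<in> carrier_mat n n" "cut_connected n A"
  shows "cut_connected n (transpose_mat A)"
  unfolding cut_connected_def
proof (intro allI impI)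
  fix P Q :: "nat \<Rightarrow> bool" assume *: "\<forall>i<n. \<forall>j<n. transpose_mat A $$ (i, j) \<noteq> 0 \<longrightarrow> P i = Q j"
  have "Q i = P j" if "i < n" "j < n" "A $$ (i, j) \<noteq> 0" for i j
    using *[rule_format, of j i] that assms(1) by auto
  then obtain b where "\<And>i. i < n \<Longrightarrow> Q i = b" "\<And>i. i < n \<Longrightarrow> P i = b"
    using cut_connectedD[OF assms(2), of Q P] by blast
  then show "\<exists>b. \<forall>i<n. P i = b \<and> Q i = b" by blast
qed

text \<open>\<open>D3\<close> is symmetric, so it suffices to exchange \<open>f\<close> with
  \<open>g\<close>, \<open>\<rho>\<close> with \<open>\<gamma>\<close> and \<open>p\<close> with
  \<open>q\<close>.\<close>

lemma attaches_D3_at_transpose: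
  assumes "attaches_D3_at n A i j B"
  shows "attaches_D3_at n (transpose_mat A) j i (transpose_mat B)"
proof -
  from assms obtain f g \<rho> \<gamma> p q where A: "A \<in> carrier_mat n n" and B: "B \<in> carrier_mat (n + 2) (n + 2)"
    and asm: "is_asm A" "is_asm B" "A $$ (i, j) = 1"
    and f: "strict_mono_on {..<n} f" "f ` {..<n} \<subseteq> {..<n + 2}"
    and g: "strict_mono_on {..<n} g" "g ` {..<n} \<subseteq> {..<n + 2}"
    and BA: "\<forall>k < n. \<forall>l < n. B $$ (f k, g l) = A $$ (k, l)"
    and \<rho>: "strict_mono_on {..<3::nat} \<rho>" "\<rho> ` {..<3} \<subseteq> {..<n + 2}"
    and \<gamma>: "strict_mono_on {..<3::nat} \<gamma>" "\<gamma> ` {..<3} \<subseteq> {..<n + 2}"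
    and D: "mat 3 3 (\<lambda>(k, l). B $$ (\<rho> k, \<gamma> l)) = D3"
    and pq: "p < 3" "q < 3" "D3 $$ (p, q) = 1"
    and newf: "{..<n + 2} - f ` {..<n} = \<rho> ` ({..<3} - {p})"
    and newg: "{..<n + 2} - g ` {..<n} = \<gamma> ` ({..<3} - {q})"
    and rest: "\<forall>k < n + 2. \<forall>l < n + 2.
           (k \<notin> f ` {..<n} \<or> l \<notin> g ` {..<n}) \<and> \<not> (k \<in> \<rho> ` {..<3} \<and> l \<in> \<gamma> ` {..<3})
           \<longrightarrow> B $$ (k, l) = 0"
    and ij: "i < n" "j < n" "f i = \<rho> p" "g j = \<gamma> q"
    unfolding attaches_D3_at_def by (elim conjE exE) (rule that)
  have BD: "B $$ (\<rho> k, \<gamma> l) = D3 $$ (k, l)" if "k < 3" "l < 3" for k l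
    using arg_cong[OF D, of "\<lambda>M. M $$ (k, l)"] that by simp
  have Bt: "transpose_mat B $$ (k, l) = B $$ (l, k)" if "k < n + 2" "l < n + 2" for k l
    using that B by auto
  have At: "transpose_mat A $$ (k, l) = A $$ (l, k)" if "k < n" "l < n" for k l
    using that A by auto
  have "mat 3 3 (\<lambda>(k, l). transpose_mat B $$ (\<gamma> k, \<rho> l)) = D3"
  proof (rule eq_matI)
    fix k l assume "k < dim_row D3" "l < dim_col D3"
    then have kl: "k < 3" "l < 3" using D3_entries(1) by auto
    then have "\<gamma> k < n + 2" "\<rho> l < n + 2" using \<rho>(2) \<gamma>(2) by blast+
    then show "mat 3 3 (\<lambda>(k, l). transpose_mat B $$ (\<gamma> k, \<rho> l)) $$ (k, l) = D3 $$ (k, l)"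
      using kl by (simp add: Bt BD D3_entries)
  qed (use D3_entries(1) in auto)
  moreover have "D3 $$ (q, p) = 1" using pq by (auto simp: D3_entries split: if_splits)
  moreover have "\<forall>k<n. \<forall>l<n. transpose_mat B $$ (g k, f l) = transpose_mat A $$ (k, l)"
  proof (intro allI impI)
    fix k l assume kl: "k < n" "l < n"
    then have "g k < n + 2" "f l < n + 2" using f g by blast+
    then show "transpose_mat B $$ (g k, f l) = transpose_mat A $$ (k, l)"
      using kl by (simp add: Bt At BA)
  qed
  moreover have "transpose_mat A $$ (j, i) = 1" using ij asm At by simp
  moreover have "\<forall>k < n + 2. \<forall>l < n + 2.
           (k \<notin> g ` {..<n} \<or> l \<notin> f ` {..<n}) \<and> \<not> (k \<in> \<gamma> ` {..<3} \<and> l \<in> \<rho> ` {..<3})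
           \<longrightarrow> transpose_mat B $$ (k, l) = 0"
    using rest Bt by auto
  moreover have "transpose_mat A \<in> carrier_mat n n" "is_asm (transpose_mat A)"
    "transpose_mat B \<in> carrier_mat (n + 2) (n + 2)" "is_asm (transpose_mat B)"
    using A B asm is_asm_transpose[OF A] is_asm_transpose[OF B] by simp_all
  ultimately show ?thesis
    unfolding attaches_D3_at_def
    using f g \<rho> \<gamma> pq newf newg ij by blast
qed

lemma attaches_D3_transpose:
  "attaches_D3 A B \<Longrightarrow> attaches_D3 (transpose_mat A) (transpose_mat B)"
  unfolding attaches_D3_def using attaches_D3_at_transpose by blast

section \<open>Pruning signed graphs\<close>

text \<open>A 2-regular graph may have several components, and the cycle found is one of them. The
  closure under \<open>N\<close> allows a connectedness argument to show later that it is the only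
  one.\<close>

lemma regular_two_cycle:
  fixes N :: "'v \<Rightarrow> 'v set"
  assumes fin: "finite C" and ne: "C \<noteq> {}"
    and sub: "\<And>x. x \<in> C \<Longrightarrow> N x \<subseteq> C" and two: "\<And>x. x \<in> C \<Longrightarrow> card (N x) = 2"
    and sym: "\<And>x y. x \<in> C \<Longrightarrow> y \<in> C \<Longrightarrow> y \<in> N x \<longleftrightarrow> x \<in> N y" and irrefl: "\<And>x. x \<notin> N x"
  obtains vs where "distinct vs" "set vs \<subseteq> C" "3 \<le> length vs"
    "\<And>i. i < length vs \<Longrightarrow> vs ! (Suc i mod length vs) \<in> N (vs ! i)"
    "\<And>x. x \<in> set vs \<Longrightarrow> N x \<subseteq> set vs"
    "\<And>x y. x \<in> set vs \<Longrightarrow> y \<in> N x \<Longrightarrow> {x, y} \<in> cycle_edges vs"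
proof -
  define path where "path xs \<longleftrightarrow> distinct xs \<and> set xs \<subseteq> C \<and>
    (\<forall>i. Suc i < length xs \<longrightarrow> xs ! Suc i \<in> N (xs ! i))" for xs
  have bound: "length xs \<le> card C" if "path xs" for xs
    using that fin card_mono distinct_card unfolding path_def by metis
  obtain x0 where x0: "x0 \<in> C" using ne by blast
  obtain a b where ab: "N x0 = {a, b}" "a \<noteq> b" using two[OF x0] by (meson card_2_iff)
  have abC: "a \<in> C" "b \<in> C" using sub[OF x0] ab by auto
  \<comment> \<open>In a longest path both neighbours of the first vertex lie on the path. The second one can only
    be the last vertex, as any other would have degree 3.\<close>
  have "path [a, x0, b]"
    unfolding path_def
    using ab abC x0 irrefl[of x0] sym[OF x0 abC(1)]
    by (auto simp: less_Suc_eq)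
  then have ex: "\<exists>xs. path xs \<and> length xs = length [a, x0, b]" by blast
  \<comment> \<open>A longest path exists because a path has at most \<open>card C\<close> vertices;
    the path through \<open>x0\<close> shows that it has at least three.\<close>
  define vs where "vs = (ARG_MAX length xs. path xs)"
  have vs: "path vs" and longest: "\<And>xs. path xs \<Longrightarrow> length xs \<le> length vs"
    using arg_max_nat_lemma[of path "[a, x0, b]" length "card C + 1"] bound \<open>path [a, x0, b]\<close>
    unfolding vs_def by (auto simp: less_Suc_eq_le)
  have len: "3 \<le> length vs" using longest[OF \<open>path [a, x0, b]\<close>] by simp
  define n where "n = length vs"
  have n: "3 \<le> n" "length vs = n" using len by (auto simp: n_def)
  have dist: "distinct vs" and vsC: "set vs \<subseteq> C" and succ: "\<And>i. Suc i < n \<Longrightarrow> vs ! Suc i \<in> N (vs ! i)"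
    using vs unfolding path_def n_def by blast+
  have inC: "vs ! i \<in> C" if "i < n" for i using vsC that n by auto
  have pred: "vs ! i \<in> N (vs ! Suc i)" if "Suc i < n" for i
    using succ[OF that] sym inC that by simp
  have inj: "vs ! i = vs ! j \<longleftrightarrow> i = j" if "i < n" "j < n" for i j
    using dist that n by (simp add: nth_eq_iff_index_eq)
  have head: "N (vs ! 0) \<subseteq> set vs"
  proof
    fix y assume y: "y \<in> N (vs ! 0)"
    have "0 < n" using n by simp
    have yC: "y \<in> C" using y sub[OF inC[OF \<open>0 < n\<close>]] by blast
    show "y \<in> set vs"
    proof (rule ccontr)
      assume ny: "y \<notin> set vs"
      have "(y # vs) ! Suc i \<in> N ((y # vs) ! i)" if "Suc i < length (y # vs)" for i
        using that y yC sym[OF inC[OF \<open>0 < n\<close>] yC] succ n by (cases i) auto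
      then have "path (y # vs)" using dist vsC ny yC unfolding path_def by auto
      then show False using longest by fastforce
    qed
  qed
  have zero: "0 < n" "Suc 0 < n" "n - 1 < n" using n by auto
  have closed: "vs ! (n - 1) \<in> N (vs ! 0)"
  proof -
    obtain c d where cd: "N (vs ! 0) = {c, d}" "c \<noteq> d"
      using two[OF inC[OF zero(1)]] by (meson card_2_iff)
    obtain e where e: "e \<in> N (vs ! 0)" "e \<noteq> vs ! 1" using cd by (cases "c = vs ! 1") auto
    obtain j where j: "j < n" "e = vs ! j" using e head n by (metis in_set_conv_nth subsetD)
    have "j \<noteq> 0" using e j irrefl by metis
    moreover have "j \<noteq> 1" using e j by blast
    ultimately have j2: "Suc (Suc (j - 2)) = j" by simp
    show ?thesis
    proof (cases "j = n - 1")
      case False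
      then have Sj: "Suc j < n" using j by simp
      have "vs ! 0 \<in> N (vs ! j)" using e j sym inC zero by metis
      moreover have "vs ! Suc j \<in> N (vs ! j)" using succ Sj by blast
      moreover have "vs ! (j - 1) \<in> N (vs ! j)" using pred[of "j - 1"] j j2 by simp
      ultimately have "{vs ! 0, vs ! Suc j, vs ! (j - 1)} \<subseteq> N (vs ! j)" by blast
      moreover have "card {vs ! 0, vs ! Suc j, vs ! (j - 1)} = 3"
      proof -
        have "j - 1 < n" "0 \<noteq> j - 1" "Suc j \<noteq> j - 1" using j j2 by linarith+
        then show ?thesis using inj[of 0 "Suc j"] inj[of 0 "j - 1"] inj[of "Suc j" "j - 1"] Sj zero by simp
      qed
      moreover have "finite (N (vs ! j))" using sub[OF inC[OF j(1)]] fin finite_subset by blast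
      ultimately have "3 \<le> card (N (vs ! j))" using card_mono by metis
      then show ?thesis using two[OF inC[OF j(1)]] by simp
    qed (use e j in simp)
  qed
  \<comment> \<open>Cyclic successor and predecessor. They differ because \<open>n\<close> is at
    least 3, so they account for both neighbours of a vertex.\<close>
  define nx where "nx i = Suc i mod n" for i
  define pv where "pv i = (if i = 0 then n - 1 else i - 1)" for i
  have nx_less: "nx i < n" "pv i < n" if "i < n" for i using that zero by (auto simp: nx_def pv_def)
  have nx_pv: "nx (pv i) = i" if "i < n" for i
    using that zero by (auto simp: nx_def pv_def)
  have nxN: "vs ! nx i \<in> N (vs ! i)" if "i < n" for i
  proof (cases "Suc i = n")
    case True
    then show ?thesis using closed sym[OF inC[of 0] inC[of i]] zero by (auto simp: nx_def)
  next
    case False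
    then show ?thesis using that succ by (simp add: nx_def)
  qed
  have N_eq: "N (vs ! i) = {vs ! nx i, vs ! pv i}" if "i < n" for i
  proof -
    have "vs ! pv i \<in> N (vs ! i)"
      using nxN[of "pv i"] nx_pv nx_less sym inC that by metis
    moreover have "nx i \<noteq> pv i" using that n by (auto simp: nx_def pv_def mod_Suc)
    then have "card {vs ! nx i, vs ! pv i} = 2"
      using inj nx_less that by simp
    moreover have "finite (N (vs ! i))" using sub[OF inC[OF that]] fin finite_subset by blast
    ultimately have "{vs ! nx i, vs ! pv i} = N (vs ! i)"
      using nxN[OF that] two[OF inC[OF that]] by (intro card_subset_eq) auto
    then show ?thesis by simp
  qed
  have edge: "{vs ! i, vs ! nx i} \<in> cycle_edges vs" if "i < n" for i
    using that n unfolding cycle_edges_def nx_def by blast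
  show thesis
  proof (rule that[of vs])
    show "N x \<subseteq> set vs" if "x \<in> set vs" for x
      using that N_eq nx_less n by (metis empty_subsetI in_set_conv_nth insert_subset nth_mem)
    show "{x, y} \<in> cycle_edges vs" if "x \<in> set vs" "y \<in> N x" for x y
    proof -
      obtain i where i: "i < n" "x = vs ! i" using \<open>x \<in> set vs\<close> n by (metis in_set_conv_nth)
      then have "y = vs ! nx i \<or> y = vs ! pv i" using N_eq that by blast
      then show ?thesis
        using edge[OF i(1)] edge[of "pv i"] nx_pv nx_less i by (metis insert_commute)
    qed
  qed (use dist vsC len nxN n nx_def in auto)
qed

text \<open>Pairs are ordered, so an edge counts twice. The only neighbour of a vertex of
  \<open>L\<close> lies outside \<open>L\<close>; hence each vertex of \<open>L\<close> takes away
  exactly its own edge, in both orientations.\<close>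

lemma card_symmetric_relation_prune:
  fixes E :: "('v \<times> 'v) set"
  assumes fin: "finite E" "finite V" and "sym E" and E: "E \<subseteq> V \<times> V"
    and L: "L \<subseteq> V" and leaf: "\<And>x. x \<in> L \<Longrightarrow> \<exists>y \<in> V - L. {z. (x, z) \<in> E} = {y}"
  shows "card E = card (E \<inter> (V - L) \<times> (V - L)) + 2 * card L"
proof -
  let ?X = "E \<inter> L \<times> (V - L)" and ?Y = "E \<inter> (V - L) \<times> L"
  obtain p where p: "\<And>x. x \<in> L \<Longrightarrow> p x \<in> V - L \<and> {z. (x, z) \<in> E} = {p x}"
    using leaf by metis
  have LL: "(x, y) \<notin> E" if "x \<in> L" "y \<in> L" for x y
  proof
    assume "(x, y) \<in> E"
    then have "y = p x" using p[OF that(1)] by blast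
    then show False using p[OF that(1)] that(2) by blast
  qed
  have X: "?X = (\<lambda>x. (x, p x)) ` L"
  proof (intro equalityI subsetI)
    fix e assume "e \<in> ?X"
    then obtain x y where e: "e = (x, y)" "x \<in> L" "(x, y) \<in> E" by blast
    then have "y = p x" using p by blast
    then show "e \<in> (\<lambda>x. (x, p x)) ` L" using e by blast
  next
    fix e assume "e \<in> (\<lambda>x. (x, p x)) ` L"
    then show "e \<in> ?X" using p by blast
  qed
  have "card ?X = card L" unfolding X by (intro card_image inj_onI) simp
  moreover have "?Y = prod.swap ` ?X" using \<open>sym E\<close> by (force dest: symD)
  then have "card ?Y = card ?X" by (simp add: card_image)
  moreover have "E = (E \<inter> (V - L) \<times> (V - L)) \<union> (?X \<union> ?Y)"
    using E LL by blast
  then have "card E = card ((E \<inter> (V - L) \<times> (V - L)) \<union> (?X \<union> ?Y))" by simp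
  moreover have "card ((E \<inter> (V - L) \<times> (V - L)) \<union> (?X \<union> ?Y)) =
      card (E \<inter> (V - L) \<times> (V - L)) + (card ?X + card ?Y)"
    using fin(1) by (subst card_Un_disjoint, simp, simp, blast)
      (subst card_Un_disjoint, auto)
  ultimately show ?thesis by simp
qed

text \<open>Rows and columns become vertices of one kind, so that no later argument has to
  distinguish them. Of alternation only the sum 1 at each vertex is kept here.\<close>

locale sign_graph =
  fixes V :: "'v set" and w :: "'v \<Rightarrow> 'v \<Rightarrow> int"
  assumes finite_V: "finite V"
    and w_sym: "w x y = w y x"
    and w_supp: "w x y \<noteq> 0 \<Longrightarrow> x \<in> V"
    and w_values: "w x y \<in> {-1, 0, 1}"
    and w_sum: "x \<in> V \<Longrightarrow> (\<Sum>y\<in>V. w x y) = 1"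
begin

definition nbrs :: "'v \<Rightarrow> 'v set" where "nbrs x = {y. w x y \<noteq> 0}"
definition leaves :: "'v set" where "leaves = {x \<in> V. card (nbrs x) = 1}"
definition inner :: "'v set" where "inner = V - leaves"
definition stems :: "'v set" where "stems = {x \<in> inner. card (nbrs x \<inter> inner) = 1}"
definition core :: "'v set" where "core = inner - stems"
text \<open>Phrased through the neighbours of \<open>v\<close> instead of degrees, which makes it
  easy to translate into a condition on matrix entries.\<close>

definition pendant_stem :: "'v \<Rightarrow> 'v \<Rightarrow> bool" where
  "pendant_stem u v \<longleftrightarrow> w u v = -1 \<and> (\<forall>x. x \<noteq> u \<longrightarrow> w v x \<noteq> 0 \<longrightarrow> x \<in> leaves)"

lemma w_supp': "w x y \<noteq> 0 \<Longrightarrow> y \<in> V"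
  using w_supp w_sym by metis

lemma nbrs_subset: "nbrs x \<subseteq> V"
  using w_supp' by (auto simp: nbrs_def)

lemma finite_nbrs: "finite (nbrs x)"
  using nbrs_subset finite_V finite_subset by blast

lemma nbrs_sym: "y \<in> nbrs x \<longleftrightarrow> x \<in> nbrs y"
  by (simp add: nbrs_def w_sym[of x])

lemma finite_value_class: "a \<noteq> 0 \<Longrightarrow> finite {y. w x y = a}"
  by (rule finite_subset[OF _ finite_nbrs[of x]]) (auto simp: nbrs_def)

lemma card_positive_negative:
  assumes "x \<in> V"
  shows "card {y. w x y = 1} = card {y. w x y = -1} + 1"
proof -
  have "(\<Sum>y\<in>V. w x y) = (\<Sum>y\<in>{y. w x y = 1} \<union> {y. w x y = -1}. w x y)"
  proof (intro sum.mono_neutral_right finite_V ballI)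
    show "{y. w x y = 1} \<union> {y. w x y = -1} \<subseteq> V" using w_supp'[of x] by force
    show "w x y = 0" if "y \<in> V - ({y. w x y = 1} \<union> {y. w x y = -1})" for y
      using that w_values[of x y] by auto
  qed
  also have "\<dots> = (\<Sum>y\<in>{y. w x y = 1}. w x y) + (\<Sum>y\<in>{y. w x y = -1}. w x y)"
    by (rule sum.union_disjoint) (auto simp: finite_value_class)
  also have "\<dots> = int (card {y. w x y = 1}) - int (card {y. w x y = -1})"
    by simp
  finally show ?thesis using w_sum[OF assms] by simp
qed

lemma nbrs_eq: "nbrs x = {y. w x y = 1} \<union> {y. w x y = -1}"
  using w_values by (auto simp: nbrs_def)

lemma card_nbrs: "card (nbrs x) = card {y. w x y = 1} + card {y. w x y = -1}"
  unfolding nbrs_eq by (rule card_Un_disjoint) (auto simp: finite_value_class)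

text \<open>As the weights at a vertex sum to 1, a vertex with d negative edges has d + 1 positive
  ones and degree 2d + 1.\<close>

lemma leaf_iff_no_negative:
  assumes "x \<in> V"
  shows "x \<in> leaves \<longleftrightarrow> {y. w x y = -1} = {}"
  using card_nbrs[of x] card_positive_negative[OF assms] assms
    card_eq_0_iff[of "{y. w x y = -1}"] finite_value_class[of "-1" x]
  by (auto simp: leaves_def)

lemma leaf_positive: "x \<in> leaves \<Longrightarrow> w x y \<noteq> 0 \<Longrightarrow> w x y = 1"
  using leaf_iff_no_negative[of x] w_values[of x y] by (auto simp: leaves_def)

lemma negative_inner: "w x y = -1 \<Longrightarrow> x \<in> inner \<and> y \<in> inner"
  using leaf_positive[of x y] leaf_positive[of y x] w_supp[of x y] w_supp'[of x y] w_sym[of x y]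
  by (auto simp: inner_def)

lemma inner_negative: "x \<in> inner \<Longrightarrow> \<exists>y. w x y = -1"
  using leaf_iff_no_negative[of x] by (auto simp: inner_def)

text \<open>An inner vertex has a negative edge, and a negative edge has inner ends. The single
  inner neighbour of a stem is therefore its single negative neighbour, and the sum 1 leaves two
  positive edges, both ending in leaves.\<close>

lemma stem_cases:
  assumes "v \<in> stems"
  obtains u x y where "pendant_stem u v" "nbrs v \<inter> inner = {u}" "nbrs v = {u, x, y}" "x \<noteq> y"
    "x \<in> leaves" "y \<in> leaves" "x \<noteq> u" "y \<noteq> u"
proof -
  have v: "v \<in> inner" "v \<in> V" "card (nbrs v \<inter> inner) = 1"
    using assms by (auto simp: stems_def inner_def)
  obtain u where u: "w v u = -1" using inner_negative v by blast
  then have "u \<in> nbrs v \<inter> inner" using negative_inner by (auto simp: nbrs_def)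
  then have only: "nbrs v \<inter> inner = {u}" using v(3) card_1_singletonE by (metis singletonD)
  have neg: "{y. w v y = -1} = {u}"
    using u only negative_inner[of v] by (auto simp: nbrs_def)
  then have "card {y. w v y = 1} = 2" using card_positive_negative[OF v(2)] by simp
  then obtain x y where xy: "{y. w v y = 1} = {x, y}" "x \<noteq> y" by (meson card_2_iff)
  then have nb: "nbrs v = {u, x, y}" using neg nbrs_eq by auto
  have "x \<noteq> u" "y \<noteq> u" using xy u by auto
  then have lv: "x \<in> leaves" "y \<in> leaves" 
    using only nb nbrs_subset[of v] by (auto simp: inner_def)
  have "pendant_stem u v"
    unfolding pendant_stem_def using u w_sym nb lv by (auto simp: nbrs_def)
  then show thesis using that only nb xy lv \<open>x \<noteq> u\<close> \<open>y \<noteq> u\<close> by blast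
qed

end

text \<open>
  The last two assumptions are what remains of the linear order of rows and columns when no \<open>D3\<close> can
  be removed: a stem at \<open>u\<close> lies between two positive edges to inner vertices, and two stems
  involve at least three such edges.
\<close>

locale irreducible_sign_graph = sign_graph V w for V :: "'v set" and w +
  assumes nonempty: "V \<noteq> {}"
    and no_leaf_edge: "x \<in> leaves \<Longrightarrow> y \<in> leaves \<Longrightarrow> w x y = 0"
    and one_stem: "pendant_stem u v \<Longrightarrow> 2 \<le> card {y \<in> inner. w u y = 1}"
    and two_stems: "pendant_stem u v \<Longrightarrow> pendant_stem u v' \<Longrightarrow> v \<noteq> v' \<Longrightarrow>
      3 \<le> card {y \<in> inner. w u y = 1}"
begin

lemma leaf_nbrs:
  assumes "x \<in> leaves"
  obtains u where "nbrs x = {u}" "u \<in> inner"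
proof -
  obtain u where u: "nbrs x = {u}" using assms by (auto simp: leaves_def card_1_singleton_iff)
  then have "u \<in> inner"
    using no_leaf_edge[OF assms, of u] nbrs_subset[of x] by (auto simp: inner_def nbrs_def)
  then show thesis using that u by blast
qed

text \<open>Two stems are never adjacent: if \<open>u\<close> were a stem, \<open>v\<close> would be
  its only inner neighbour, while \<open>one_stem\<close> demands positive inner neighbours of
  \<open>u\<close>.\<close>

lemma stem_core:
  assumes "v \<in> stems"
  obtains u where "pendant_stem u v" "nbrs v \<inter> inner = {u}" "u \<in> core"
proof -
  obtain u where u: "pendant_stem u v" "nbrs v \<inter> inner = {u}" using stem_cases[OF assms] by metis
  have wuv: "w u v = -1" using u by (simp add: pendant_stem_def)
  have "u \<notin> stems"
  proof
    assume "u \<in> stems"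
    then obtain u' where "nbrs u \<inter> inner = {u'}" using stem_cases by metis
    moreover have "v \<in> nbrs u \<inter> inner" using wuv negative_inner by (auto simp: nbrs_def)
    ultimately have "nbrs u \<inter> inner = {v}" by auto
    moreover have "y \<in> nbrs u \<inter> inner" if "y \<in> inner" "w u y = 1" for y
      using that by (simp add: nbrs_def)
    ultimately have "{y \<in> inner. w u y = 1} = {}" using wuv by force
    then show False using one_stem[OF u(1)] by (metis card.empty not_numeral_le_zero)
  qed
  then have "u \<in> core" using wuv negative_inner by (auto simp: core_def)
  then show thesis using that u by blast
qed

lemma inner_decomp: "inner = core \<union> stems" "core \<inter> stems = {}" "V = core \<union> stems \<union> leaves"
  "core \<inter> leaves = {}" "stems \<inter> leaves = {}"
  by (auto simp: core_def stems_def inner_def leaves_def)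

text \<open>The only inner edge at a stem is negative.\<close>

lemma positive_inner_core:
  assumes "u \<in> core" "y \<in> inner" "w u y = 1"
  shows "y \<in> core"
proof (rule ccontr)
  assume "y \<notin> core"
  then have "y \<in> stems" using assms(2) inner_decomp by auto
  then obtain v where "pendant_stem v y" "nbrs y \<inter> inner = {v}" using stem_cases by metis
  moreover have "u \<in> nbrs y \<inter> inner" using assms inner_decomp w_sym[of u y] by (auto simp: nbrs_def)
  ultimately show False using assms(3) by (auto simp: pendant_stem_def)
qed

text \<open>If a stem hangs at \<open>u\<close>, then \<open>one_stem\<close> supplies two positive
  inner neighbours, and these belong to the core. Otherwise all inner neighbours of \<open>u\<close>
  are in the core; there is one along a negative edge, and exactly one would make \<open>u\<close> a
  stem.\<close>

lemma core_degree:
  assumes "u \<in> core"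
  shows "2 \<le> card (nbrs u \<inter> core)"
proof (cases "\<exists>v \<in> stems. v \<in> nbrs u")
  case True
  then obtain v where v: "v \<in> stems" "v \<in> nbrs u" by blast
  obtain u' where u': "pendant_stem u' v" "nbrs v \<inter> inner = {u'}" using stem_cases[OF v(1)] by metis
  moreover have "u \<in> nbrs v \<inter> inner" using v assms nbrs_sym inner_decomp by auto
  ultimately have "pendant_stem u v" by auto
  then have "2 \<le> card {y \<in> inner. w u y = 1}" by (rule one_stem)
  also have "\<dots> \<le> card (nbrs u \<inter> core)"
    using positive_inner_core[OF assms] finite_nbrs
    by (intro card_mono) (auto simp: nbrs_def)
  finally show ?thesis .
next
  case False
  then have eq: "nbrs u \<inter> inner = nbrs u \<inter> core" using inner_decomp by auto
  obtain y where y: "w u y = -1" using inner_negative assms inner_decomp by blast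
  then have "y \<in> nbrs u \<inter> inner" using negative_inner by (auto simp: nbrs_def)
  then have "card (nbrs u \<inter> inner) \<noteq> 0" using finite_nbrs by auto
  moreover have "card (nbrs u \<inter> inner) \<noteq> 1" using assms by (auto simp: core_def stems_def)
  ultimately show ?thesis using eq by simp
qed

lemma core_nonempty: "core \<noteq> {}"
proof -
  obtain x where "x \<in> V" using nonempty by blast
  then have "inner \<noteq> {}" using leaf_nbrs inner_decomp by (metis Un_iff empty_iff)
  then show ?thesis using stem_core inner_decomp by (metis Un_iff ex_in_conv)
qed

text \<open>Two rounds of pruning, leaves and then stems, each costing two ordered pairs per deleted
  vertex. The pairs that remain are counted by degrees in the core.\<close>

lemma card_edges:
  "card {(x, y). w x y \<noteq> 0} = (\<Sum>u\<in>core. card (nbrs u \<inter> core)) + 2 * card stems + 2 * card leaves"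
proof -
  let ?E = "{(x, y). w x y \<noteq> 0}"
  have E: "?E \<subseteq> V \<times> V" using w_supp w_supp' by auto
  have finE: "finite ?E" using E finite_V finite_subset by blast
  have symE: "sym ?E" using w_sym by (auto simp: sym_def)
  have "card ?E = card (?E \<inter> inner \<times> inner) + 2 * card leaves"
    unfolding inner_def
  proof (rule card_symmetric_relation_prune[OF finE finite_V symE E])
    show "\<exists>y\<in>V - leaves. {z. (x, z) \<in> ?E} = {y}" if "x \<in> leaves" for x
      using leaf_nbrs[OF that] unfolding inner_def nbrs_def by auto
  qed (auto simp: leaves_def)
  moreover have "card (?E \<inter> inner \<times> inner) =
      card ((?E \<inter> inner \<times> inner) \<inter> (inner - stems) \<times> (inner - stems)) + 2 * card stems"
  proof (rule card_symmetric_relation_prune)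
    show "\<exists>y\<in>inner - stems. {z. (x, z) \<in> ?E \<inter> inner \<times> inner} = {y}" if x: "x \<in> stems" for x
    proof -
      obtain u where "nbrs x \<inter> inner = {u}" "u \<in> core" using stem_core[OF x] by metis
      moreover have "{z. (x, z) \<in> ?E \<inter> inner \<times> inner} = nbrs x \<inter> inner"
        using x by (auto simp: nbrs_def stems_def)
      ultimately show ?thesis by (auto simp: core_def)
    qed
    show "finite inner" using finite_V by (simp add: inner_def)
    show "sym (?E \<inter> inner \<times> inner)" using symE by (auto simp: sym_def)
  qed (use finE in \<open>auto simp: stems_def\<close>)
  moreover have "(?E \<inter> inner \<times> inner) \<inter> (inner - stems) \<times> (inner - stems) =
      (SIGMA u:core. nbrs u \<inter> core)"
    by (auto simp: core_def nbrs_def)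
  moreover have "card (SIGMA u:core. nbrs u \<inter> core) = (\<Sum>u\<in>core. card (nbrs u \<inter> core))"
    using finite_V finite_nbrs by (intro card_SigmaI) (auto simp: core_def inner_def)
  ultimately show ?thesis by simp
qed

lemma card_V: "card V = card core + card stems + card leaves"
  using finite_V inner_decomp
  by (metis (no_types, lifting) card_Un_disjoint finite_Un Int_Un_distrib2 Un_empty_left)

text \<open>Deleted vertices contribute exactly 2 each, so all slack is in the core degrees;
  equality makes the core 2-regular.\<close>

lemma card_edges_ge: "2 * card V \<le> card {(x, y). w x y \<noteq> 0}"
proof -
  have "2 * card core = (\<Sum>u\<in>core. 2)" by simp
  also have "\<dots> \<le> (\<Sum>u\<in>core. card (nbrs u \<inter> core))" by (rule sum_mono) (rule core_degree)
  finally show ?thesis using card_edges card_V by simp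
qed

lemma core_regular:
  assumes "card {(x, y). w x y \<noteq> 0} = 2 * card V" and u: "u \<in> core"
  shows "card (nbrs u \<inter> core) = 2"
proof (rule ccontr)
  assume "card (nbrs u \<inter> core) \<noteq> 2"
  then have "2 < card (nbrs u \<inter> core)" using core_degree[OF u] by simp
  moreover have "finite core" using finite_V by (simp add: core_def inner_def)
  ultimately have "(\<Sum>u\<in>core. 2) < (\<Sum>u\<in>core. card (nbrs u \<inter> core))"
    using u core_degree by (intro sum_strict_mono_ex1) auto
  then show False using assms card_edges card_V by simp
qed

end

section \<open>The case of equality\<close>

context irreducible_sign_graph
begin

text \<open>Leaves and stems have exactly one inner neighbour, so \<open>the_elem\<close> is
  meaningful off the core.\<close>

definition parent :: "'v \<Rightarrow> 'v" where "parent z = the_elem (nbrs z \<inter> inner)"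
text \<open>The core vertex carrying the branch that contains \<open>z\<close>.\<close>

definition root :: "'v \<Rightarrow> 'v" where
  "root z = (if parent z \<in> core then parent z else parent (parent z))"
definition branch :: "'v \<Rightarrow> 'v set" where "branch u = {z \<in> V - core. root z = u}"
text \<open>Each edge outside the core is recorded by its end farther from the core, that is, by a
  vertex of the branch.\<close>

definition branch_edges :: "int \<Rightarrow> 'v \<Rightarrow> 'v set set" where
  "branch_edges a u = {{z, parent z} | z. z \<in> branch u \<and> w z (parent z) = a}"
definition core_edges :: "int \<Rightarrow> 'v set set" where
  "core_edges a = {{x, y} | x y. x \<in> core \<and> y \<in> core \<and> w x y = a}"

lemma parent_stem:
  assumes "z \<in> stems"
  shows "nbrs z \<inter> inner = {parent z}" "parent z \<in> core" "pendant_stem (parent z) z"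
    "w z (parent z) = -1"
proof -
  obtain u where u: "pendant_stem u z" "nbrs z \<inter> inner = {u}" "u \<in> core"
    using stem_core[OF assms] by metis
  then have "parent z = u" by (simp add: parent_def)
  then show "nbrs z \<inter> inner = {parent z}" "parent z \<in> core" "pendant_stem (parent z) z"
    "w z (parent z) = -1"
    using u w_sym by (simp_all add: pendant_stem_def)
qed

lemma parent_leaf:
  assumes "z \<in> leaves"
  shows "nbrs z = {parent z}" "parent z \<in> inner" "w z (parent z) = 1"
proof -
  obtain u where u: "nbrs z = {u}" "u \<in> inner" using leaf_nbrs[OF assms] by metis
  then have "parent z = u" by (simp add: parent_def)
  then show "nbrs z = {parent z}" "parent z \<in> inner" using u by simp_all
  then show "w z (parent z) = 1" using leaf_positive[OF assms] unfolding nbrs_def by blast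
qed

lemma parent_unique:
  assumes "z \<in> V - core" "y \<in> nbrs z" "y \<in> inner"
  shows "parent z = y"
proof (cases "z \<in> stems")
  case True
  have "y \<in> nbrs z \<inter> inner" using assms by simp
  then show ?thesis unfolding parent_stem(1)[OF True] by simp
next
  case False
  then have "z \<in> leaves" using assms(1) inner_decomp(3) by blast
  then have "y \<in> {parent z}" using assms(2) parent_leaf(1) by metis
  then show ?thesis by simp
qed

lemma parent_nbr:
  assumes "z \<in> V - core"
  shows "parent z \<in> nbrs z" "parent z \<in> inner"
proof -
  have "parent z \<in> nbrs z \<and> parent z \<in> inner"
  proof (cases "z \<in> stems")
    case True
    then show ?thesis using parent_stem(1)[OF True] by blast
  next
    case False
    then have "z \<in> leaves" using assms(1) inner_decomp(3) by blast
    then show ?thesis using parent_leaf by blast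
  qed
  then show "parent z \<in> nbrs z" "parent z \<in> inner" by auto
qed

lemma root_core:
  assumes "z \<in> V - core"
  shows "root z \<in> core"
proof (cases "parent z \<in> core")
  case False
  then have "parent z \<in> stems" using parent_nbr[OF assms] inner_decomp by blast
  then show ?thesis using False parent_stem by (simp add: root_def)
qed (simp add: root_def)

lemma root_parent:
  assumes "z \<in> V - core" "parent z \<notin> core"
  shows "root (parent z) = root z"
proof -
  have "parent z \<in> stems" using parent_nbr[OF assms(1)] assms(2) inner_decomp by blast
  then show ?thesis using assms(2) parent_stem by (simp add: root_def)
qed

text \<open>Of two adjacent vertices at least one is inner, and an inner neighbour of a vertex
  outside the core is its parent.\<close>

lemma edge_cases:
  assumes "w x y \<noteq> 0"
  obtains (core) "x \<in> core" "y \<in> core"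
  | (left) "x \<in> V - core" "y = parent x"
  | (right) "y \<in> V - core" "x = parent y"
proof -
  have V: "x \<in> V" "y \<in> V" using assms w_supp w_supp' by auto
  have nb: "y \<in> nbrs x" "x \<in> nbrs y" using assms w_sym[of x y] by (auto simp: nbrs_def)
  have "x \<in> inner \<or> y \<in> inner" using no_leaf_edge assms V by (auto simp: inner_def)
  then show thesis
    using that V nb parent_unique[of x y] parent_unique[of y x] inner_decomp(1)
    by (metis DiffI Diff_iff Un_iff inner_def inner_decomp(3) core_def)
qed

text \<open>A stem hangs on a core vertex and a leaf on a core vertex or a stem, so branches have
  depth at most two.\<close>

lemma branch_iff:
  assumes u: "u \<in> core"
  shows "branch u = (nbrs u \<inter> stems) \<union> (nbrs u \<inter> leaves) \<union> {z \<in> leaves. parent z \<in> nbrs u \<inter> stems}"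
proof (rule Set.set_eqI)
  fix z
  have child: "parent z = u \<longleftrightarrow> z \<in> nbrs u" if "z \<in> V - core" for z
    using parent_nbr(1)[OF that] parent_unique[OF that] u inner_decomp(1) nbrs_sym by blast
  consider "z \<notin> V - core" | "z \<in> stems" | "z \<in> leaves" "parent z \<in> core"
    | "z \<in> leaves" "parent z \<in> stems"
    using parent_leaf(2)[of z] inner_decomp by blast
  then show "z \<in> branch u \<longleftrightarrow>
    z \<in> (nbrs u \<inter> stems) \<union> (nbrs u \<inter> leaves) \<union> {z \<in> leaves. parent z \<in> nbrs u \<inter> stems}"
  proof cases
    case 1
    then have "z \<notin> stems" "z \<notin> leaves" using inner_decomp by blast+
    then show ?thesis using 1 by (simp add: branch_def)
  next
    case 2
    then have "z \<in> V - core" "z \<notin> leaves" using inner_decomp by blast+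
    then show ?thesis using 2 child[of z] parent_stem(2)[OF 2] by (simp add: branch_def root_def)
  next
    case 3
    then have "z \<in> V - core" "z \<notin> stems" "parent z \<notin> stems" using inner_decomp by blast+
    then show ?thesis using 3 child[of z] by (simp add: branch_def root_def)
  next
    case 4
    then have z: "z \<in> V - core" "z \<notin> stems" "parent z \<notin> core" "parent z \<in> V - core" "parent z \<noteq> u"
      using inner_decomp u by blast+
    have "z \<notin> nbrs u" using child[OF z(1)] z(5) by blast
    then show ?thesis using 4 z child[OF z(4)] by (simp add: branch_def root_def)
  qed
qed

text \<open>With \<open>k\<close> positive core edges at \<open>u\<close> there are
  \<open>2 - k\<close> negative ones. All other positive edges go to the leaves \<open>L\<close>,
  all other negative ones to the stems \<open>S\<close>, and the sum 1 at \<open>u\<close> gives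
  \<open>2 * k + card L = 3 + card S\<close>. The bounds inherited from the order restrict
  \<open>S\<close>: a stem needs \<open>k\<close> at least 2, and two stems would need at least
  3.\<close>

lemma pendant_branch:
  assumes u: "u \<in> core" and reg: "card (nbrs u \<inter> core) = 2"
  shows "pendant (card {y \<in> core. w u y = 1}) u (branch u) (branch_edges 1 u) (branch_edges (-1) u)"
proof -
  define k where "k = card {y \<in> core. w u y = 1}"
  define S where "S = nbrs u \<inter> stems"
  define L where "L = nbrs u \<inter> leaves"
  have uV: "u \<in> V" "u \<in> inner" using u inner_decomp by blast+
  have fin: "finite S" "finite L" "finite {y \<in> core. w u y = 1}" "finite {y \<in> core. w u y = -1}"
    using finite_nbrs finite_value_class[of 1 u] finite_value_class[of "-1" u]
    by (auto simp: S_def L_def)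
  have S: "parent d = u" "w u d = -1" "w d u = -1" "pendant_stem u d" "d \<in> stems" if "d \<in> S" for d
  proof -
    show d: "d \<in> stems" using that by (simp add: S_def)
    have "u \<in> nbrs d" using that nbrs_sym by (auto simp: S_def)
    then show "parent d = u" using parent_unique d uV inner_decomp by blast
    then show "w d u = -1" "pendant_stem u d" "w u d = -1"
      using parent_stem[OF d] w_sym by auto
  qed
  have L: "parent l = u" "w u l = 1" "w l u = 1" "l \<in> leaves" if "l \<in> L" for l
  proof -
    show l: "l \<in> leaves" using that by (simp add: L_def)
    have "u \<in> nbrs l" using that nbrs_sym by (auto simp: L_def)
    then show "parent l = u" using parent_unique l uV inner_decomp by blast
    then show "w l u = 1" "w u l = 1" using parent_leaf[OF l] w_sym by auto
  qed
  have nbrs_u: "y \<in> core \<or> y \<in> S \<or> y \<in> L" if "w u y \<noteq> 0" for y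
    using that w_supp'[OF that] inner_decomp(3) unfolding S_def L_def nbrs_def by blast
  have pos: "{y. w u y = 1} = {y \<in> core. w u y = 1} \<union> L"
  proof -
    have "y \<in> core \<or> y \<in> L" if "w u y = 1" for y
      using that nbrs_u[of y] S(2)[of y] by auto
    then show ?thesis using L by auto
  qed
  have neg: "{y. w u y = -1} = {y \<in> core. w u y = -1} \<union> S"
  proof -
    have "y \<in> core \<or> y \<in> S" if "w u y = -1" for y
      using that nbrs_u[of y] L(2)[of y] by auto
    then show ?thesis using S by auto
  qed
  have "core \<inter> L = {}" "core \<inter> S = {}" using inner_decomp by (auto simp: S_def L_def)
  then have "card {y. w u y = 1} = k + card L"
    "card {y. w u y = -1} = card {y \<in> core. w u y = -1} + card S"
    unfolding pos neg k_def using fin by (auto intro!: card_Un_disjoint)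
  moreover have "k + card {y \<in> core. w u y = -1} = 2"
  proof -
    have "nbrs u \<inter> core = {y \<in> core. w u y = 1} \<union> {y \<in> core. w u y = -1}"
      using nbrs_eq by auto
    then show ?thesis using reg fin unfolding k_def
      by (subst card_Un_disjoint[symmetric]) auto
  qed
  ultimately have count: "2 * k + card L = 3 + card S" "k \<le> 2"
    using card_positive_negative[OF uV(1)] by linarith+
  have pos_inner: "{y \<in> inner. w u y = 1} \<subseteq> {y \<in> core. w u y = 1}"
    using positive_inner_core[OF u] by auto
  have kS: "2 \<le> k" if nz: "S \<noteq> {}"
  proof -
    obtain d where "d \<in> S" using nz by blast
    then have "2 \<le> card {y \<in> inner. w u y = 1}" using one_stem S by blast
    then show ?thesis using card_mono[OF fin(3) pos_inner] by (simp add: k_def)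
  qed
  have S1: "card S \<le> 1"
  proof (rule ccontr)
    assume "\<not> card S \<le> 1"
    then obtain d e where "d \<in> S" "e \<in> S" "d \<noteq> e"
      using card_le_Suc0_iff_eq[OF fin(1)] by (metis One_nat_def)
    then have "3 \<le> card {y \<in> inner. w u y = 1}" using two_stems S by metis
    then have "3 \<le> k" using card_mono[OF fin(3) pos_inner] by (simp add: k_def)
    then show False using count by simp
  qed
  have noS: "branch u = L" "branch_edges 1 u = {{u, l} | l. l \<in> L}" "branch_edges (-1) u = {}" if "S = {}"
  proof -
    show b: "branch u = L" using branch_iff[OF u] that by (auto simp: S_def L_def)
    have z: "{z, parent z} = {u, z}" "w z (parent z) = 1" if "z \<in> L" for z using L[OF that] by auto
    show "branch_edges 1 u = {{u, l} | l. l \<in> L}"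
      unfolding branch_edges_def b using z by (intro Collect_cong) metis
    have "w z (parent z) \<noteq> -1" if "z \<in> L" for z using z(2)[OF that] by simp
    then show "branch_edges (-1) u = {}" unfolding branch_edges_def b by blast
  qed
  \<comment> \<open>The equation now leaves one stem and no leaf for \<open>k = 2\<close>, one leaf
    for \<open>k = 1\<close> and three leaves for \<open>k = 0\<close>: the three shapes of
    \<open>pendant\<close>.\<close>
  consider "k = 2" | "k = 1" | "k = 0" using count by linarith
  then show ?thesis
    unfolding k_def[symmetric]
  proof cases
    case 1
    then have "card S = 1" "card L = 0" using count S1 by linarith+
    then obtain d where Sd: "S = {d}" and L0: "L = {}" using fin by (auto simp: card_1_singleton_iff)
    have d: "d \<in> stems" "parent d = u" "w d u = -1" using S Sd by auto
    obtain u' x y where xy: "nbrs d \<inter> inner = {u'}" "nbrs d = {u', x, y}" "x \<noteq> y"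
      "x \<in> leaves" "y \<in> leaves"
      using stem_cases[OF d(1)] by metis
    have "d \<in> nbrs x" "d \<in> nbrs y" using xy(2) nbrs_sym[of d] by auto
    then have px: "parent x = d" "parent y = d"
      using parent_leaf(1)[OF xy(4)] parent_leaf(1)[OF xy(5)] by (metis singletonD)+
    have dist: "distinct [d, x, y]" using xy d inner_decomp by auto
    have b: "branch u = {d, x, y}"
    proof -
      have "z \<in> {x, y}" if "z \<in> leaves" "parent z = d" for z
      proof -
        have "d \<in> nbrs z" using parent_leaf(1)[OF that(1)] that(2) by simp
        then have "z \<in> nbrs d" using nbrs_sym by metis
        moreover have "z \<noteq> u'" using xy(1) that(1) inner_decomp by blast
        ultimately show ?thesis using xy(2) by blast
      qed
      then have "{z \<in> leaves. parent z \<in> S} = {x, y}" using Sd px xy by auto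
      then show ?thesis using branch_iff[OF u] Sd L0 by (auto simp: S_def L_def)
    qed
    have e: "w x (parent x) = 1" "w y (parent y) = 1" using parent_leaf xy by auto
    have "branch_edges 1 u = {{d, x}, {d, y}}" "branch_edges (-1) u = {{u, d}}"
    proof -
      have be: "branch_edges a u = (\<lambda>z. {z, parent z}) ` {z \<in> {d, x, y}. w z (parent z) = a}" for a
        unfolding branch_edges_def b by auto
      have "{z \<in> {d, x, y}. w z (parent z) = 1} = {x, y}" using e d by auto
      then show "branch_edges 1 u = {{d, x}, {d, y}}"
        unfolding be using px by (simp add: insert_commute)
      have "{z \<in> {d, x, y}. w z (parent z) = -1} = {d}" using e d by auto
      then show "branch_edges (-1) u = {{u, d}}"
        unfolding be using d by (simp add: insert_commute)
    qed
    then show "pendant k u (branch u) (branch_edges 1 u) (branch_edges (-1) u)"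
      using both_positive[OF dist] 1 b by simp
  next
    case 2
    then have S0: "S = {}" using kS by auto
    then have "card L = 1" using count 2 by simp
    then obtain l where "L = {l}" by (auto simp: card_1_singleton_iff)
    then show "pendant k u (branch u) (branch_edges 1 u) (branch_edges (-1) u)"
      using noS[OF S0] 2 one_positive by simp
  next
    case 3
    then have S0: "S = {}" using kS by auto
    then have "card L = 3" using count 3 by simp
    then obtain x y z where l: "L = {x, y, z}" "x \<noteq> y" "x \<noteq> z" "y \<noteq> z" by (auto simp: card_3_iff)
    then have "branch_edges 1 u = {{u, x}, {u, y}, {u, z}}" using noS[OF S0] by auto
    then show "pendant k u (branch u) (branch_edges 1 u) (branch_edges (-1) u)"
      using noS[OF S0] 3 both_negative[of x y z u] l by simp
  qed
qed

text \<open>Connectedness makes one cycle exhaust the core. Bipartiteness excludes loops and makes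
  the cycle even.\<close>

lemma basic_unicyclic:
  assumes eq: "card {(x, y). w x y \<noteq> 0} = 2 * card V"
    and conn: "\<And>S. S \<noteq> {} \<Longrightarrow> S \<subseteq> V \<Longrightarrow> (\<And>x y. x \<in> S \<Longrightarrow> w x y \<noteq> 0 \<Longrightarrow> y \<in> S) \<Longrightarrow> S = V"
    and bip: "\<And>x y. w x y \<noteq> 0 \<Longrightarrow> side x \<noteq> (side y :: bool)"
  shows "basic_unicyclic_graph
    \<lparr> sg_verts = V, pos_edges = {{x, y} | x y. w x y = 1}, neg_edges = {{x, y} | x y. w x y = -1} \<rparr>"
proof -
  have fin_core: "finite core" using finite_V by (simp add: core_def inner_def)
  obtain vs where vs: "distinct vs" "set vs \<subseteq> core" "3 \<le> length vs"
    and succ: "\<And>i. i < length vs \<Longrightarrow> vs ! (Suc i mod length vs) \<in> nbrs (vs ! i) \<inter> core"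
    and closed: "\<And>x. x \<in> set vs \<Longrightarrow> nbrs x \<inter> core \<subseteq> set vs"
    and edge: "\<And>x y. x \<in> set vs \<Longrightarrow> y \<in> nbrs x \<inter> core \<Longrightarrow> {x, y} \<in> cycle_edges vs"
  proof (rule regular_two_cycle[of core "\<lambda>x. nbrs x \<inter> core"])
    show "card (nbrs x \<inter> core) = 2" if "x \<in> core" for x using core_regular[OF eq that] .
    show "y \<in> nbrs x \<inter> core \<longleftrightarrow> x \<in> nbrs y \<inter> core" if "x \<in> core" "y \<in> core" for x y
      using that nbrs_sym by blast
    show "x \<notin> nbrs x \<inter> core" for x using bip[of x x] by (auto simp: nbrs_def)
  qed (use fin_core core_nonempty in blast)+
  have len0: "0 < length vs" using vs(3) by linarith
  \<comment> \<open>The cycle together with all branches rooted on it. No edge leaves this set, so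
    by connectedness there is no second cycle in the core.\<close>
  define S where "S = set vs \<union> {z \<in> V - core. root z \<in> set vs}"
  have "S = V"
  proof (rule conn)
    show "S \<noteq> {}" using len0 by (simp add: S_def)
    show "S \<subseteq> V" using vs(2) inner_decomp by (auto simp: S_def)
    fix x y assume x: "x \<in> S" and xy: "w x y \<noteq> 0"
    from xy show "y \<in> S"
    proof (cases rule: edge_cases)
      case core
      then show ?thesis using x xy closed[of x] by (auto simp: S_def nbrs_def)
    next
      case left
      then have "root x \<in> set vs" using x vs(2) by (auto simp: S_def)
      then show ?thesis
      proof (cases "y \<in> core")
        case True
        then show ?thesis using \<open>root x \<in> set vs\<close> left by (simp add: S_def root_def)
      next
        case False
        then have "root y = root x" "y \<in> V" using root_parent left w_supp'[OF xy] by auto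
        then show ?thesis using False \<open>root x \<in> set vs\<close> by (simp add: S_def)
      qed
    next
      case right
      have "root y \<in> set vs"
      proof (cases "x \<in> core")
        case True
        then have "x \<in> set vs" using x by (auto simp: S_def)
        then show ?thesis using True right by (simp add: root_def)
      next
        case False
        then have "root x = root y" using root_parent right by auto
        then show ?thesis using False x vs(2) by (auto simp: S_def)
      qed
      then show ?thesis using right by (simp add: S_def)
    qed
  qed
  then have core: "set vs = core" using vs(2) inner_decomp(3) unfolding S_def by blast
  define m where "m = length vs div 2"
  have sides: "side (vs ! i) = (side (vs ! 0) = even i)" if "i < length vs" for i
    using that
  proof (induction i)
    case (Suc i)
    then have "w (vs ! i) (vs ! Suc i) \<noteq> 0" using succ[of i] by (auto simp: nbrs_def)
    then show ?case using bip Suc by auto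
  qed simp
  have "w (vs ! (length vs - 1)) (vs ! 0) \<noteq> 0"
    using succ[of "length vs - 1"] len0 by (auto simp: nbrs_def)
  then have "odd (length vs - 1)"
    using bip sides[of "length vs - 1"] len0 by auto
  \<comment> \<open>An even length that is at least 3 is at least 4.\<close>
  then have m: "length vs = 2 * m" "2 \<le> m" using vs(3) by (auto simp: m_def)
  have w1: "w x y = a" if "{x, y} = {x', y'}" "w x' y' = a" for x y x' y' a
    using that w_sym by (auto simp: doubleton_eq_iff)
  have cyc: "core_edges 1 \<union> core_edges (-1) = cycle_edges vs"
  proof (intro equalityI subsetI)
    fix e assume "e \<in> core_edges 1 \<union> core_edges (-1)"
    then obtain x y where "e = {x, y}" "x \<in> core" "y \<in> core" "w x y \<noteq> 0"
      by (auto simp: core_edges_def)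
    then show "e \<in> cycle_edges vs" using edge core by (auto simp: nbrs_def)
  next
    fix e assume "e \<in> cycle_edges vs"
    then obtain i where i: "i < length vs" "e = {vs ! i, vs ! (Suc i mod length vs)}"
      by (auto simp: cycle_edges_def)
    have "vs ! i \<in> core" using nth_mem[OF i(1)] unfolding core .
    then show "e \<in> core_edges 1 \<union> core_edges (-1)"
    proof -
      let ?y = "vs ! (Suc i mod length vs)"
      have "?y \<in> core" "w (vs ! i) ?y \<noteq> 0" using succ[OF i(1)] by (auto simp: nbrs_def)
      moreover from this(2) have "w (vs ! i) ?y = 1 \<or> w (vs ! i) ?y = -1"
        using w_values[of "vs ! i" ?y] by auto
      ultimately show ?thesis using \<open>vs ! i \<in> core\<close> i(2) unfolding core_edges_def by blast
    qed
  qed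
  have disj: "core_edges 1 \<inter> core_edges (-1) = {}"
  proof (rule ccontr)
    assume "core_edges 1 \<inter> core_edges (-1) \<noteq> {}"
    then obtain x y x' y' where "{x, y} = {x', y'}" "w x y = 1" "w x' y' = -1"
      unfolding core_edges_def by blast
    then show False using w1[of x y x' y' "-1"] by simp
  qed
  have pend: "pendant (card {e \<in> core_edges 1. v \<in> e}) v (branch v) (branch_edges 1 v) (branch_edges (-1) v)"
    if v: "v \<in> core" for v
  proof -
    \<comment> \<open>\<open>pendant\<close> is indexed by positive cycle edges at \<open>v\<close>,
      \<open>pendant_branch\<close> by positive core neighbours; the map from \<open>y\<close> to
      \<open>{v, y}\<close> matches the two.\<close>
    have "{e \<in> core_edges 1. v \<in> e} = (\<lambda>y. {v, y}) ` {y \<in> core. w v y = 1}"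
    proof (intro equalityI subsetI)
      fix e assume "e \<in> {e \<in> core_edges 1. v \<in> e}"
      then obtain x y where "e = {x, y}" "x \<in> core" "y \<in> core" "w x y = 1" "v = x \<or> v = y"
        by (auto simp: core_edges_def)
      then show "e \<in> (\<lambda>y. {v, y}) ` {y \<in> core. w v y = 1}"
        using w_sym[of x y] by (auto simp: insert_commute)
    qed (use v in \<open>auto simp: core_edges_def\<close>)
    moreover have "inj_on (\<lambda>y. {v, y}) {y \<in> core. w v y = 1}"
      by (auto simp: inj_on_def doubleton_eq_iff)
    ultimately have "card {e \<in> core_edges 1. v \<in> e} = card {y \<in> core. w v y = 1}"
      by (simp add: card_image)
    then show ?thesis using pendant_branch[OF v core_regular[OF eq v]] by simp
  qed
  have verts: "V = core \<union> (\<Union>v\<in>core. branch v)"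
    using root_core inner_decomp(3) by (auto simp: branch_def)
  have edges: "{{x, y} | x y. w x y = a} = core_edges a \<union> (\<Union>v\<in>core. branch_edges a v)"
    if a: "a \<noteq> 0" for a
  proof (intro equalityI subsetI)
    fix e assume "e \<in> {{x, y} | x y. w x y = a}"
    then obtain x y where e: "e = {x, y}" "w x y = a" by blast
    then have "w x y \<noteq> 0" using a by simp
    then show "e \<in> core_edges a \<union> (\<Union>v\<in>core. branch_edges a v)"
    proof (cases rule: edge_cases)
      case core
      then show ?thesis using e by (auto simp: core_edges_def)
    next
      case left
      then have "e \<in> branch_edges a (root x)" using e by (auto simp: branch_edges_def branch_def)
      then show ?thesis using root_core left by blast
    next
      case right
      then have "e \<in> branch_edges a (root y)"
        using e w_sym[of x y] by (auto simp: branch_edges_def branch_def insert_commute)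
      then show ?thesis using root_core right by blast
    qed
  qed (auto simp: core_edges_def branch_edges_def)
  show ?thesis
    unfolding basic_unicyclic_graph_def core[symmetric]
    using m vs(1) cyc disj pend verts edges[of 1] edges[of "-1"] unfolding core[symmetric]
    by (intro exI[of _ m] exI[of _ vs] exI[of _ "core_edges 1"] exI[of _ "core_edges (-1)"]
        exI[of _ branch] exI[of _ "branch_edges 1"] exI[of _ "branch_edges (-1)"])
      (auto simp: branch_def core)
qed

end

section \<open>The graph of an irreducible ASM\<close>

lemma asm_col_sum:
  assumes "is_asm A" "A \<in> carrier_mat n n" "j < n"
  shows "(\<Sum>i<n. A $$ (i, j)) = 1"
  using assms by (simp add: is_asm_iff_alt_on alt_on_def)

lemma asm_row_sum:
  assumes "is_asm A" "A \<in> carrier_mat n n" "i < n"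
  shows "(\<Sum>j<n. A $$ (i, j)) = 1"
  using assms by (simp add: is_asm_iff_alt_on alt_on_def)

text \<open>
  Stated for a function instead of a matrix so that rows and columns can be exchanged.
\<close>

definition stem_flanks_branch :: "nat \<Rightarrow> (nat \<Rightarrow> nat \<Rightarrow> int) \<Rightarrow> bool" where
  "stem_flanks_branch n a \<longleftrightarrow>
    (\<forall>r c. r < n \<longrightarrow> c < n \<longrightarrow> a r c = -1 \<longrightarrow>
      (\<forall>l<n. l \<noteq> c \<longrightarrow> a r l \<noteq> 0 \<longrightarrow> (\<forall>k<n. k \<noteq> r \<longrightarrow> a k l = 0)) \<longrightarrow>
      (\<exists>q s. q < r \<and> r < s \<and> s < n \<and> a q c = 1 \<and> a s c = 1 \<and>
        (\<forall>k. q < k \<longrightarrow> k < s \<longrightarrow> k \<noteq> r \<longrightarrow> a k c = 0) \<and>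
        (\<exists>l<n. l \<noteq> c \<and> a q l \<noteq> 0) \<and> (\<exists>l<n. l \<noteq> c \<and> a s l \<noteq> 0)))"

text \<open>If the nearest +1 above or below the -1 were the only nonzero entry of its row, that row
  could play the part of \<open>s\<close> in \<open>remove_D3\<close>, with the other flank
  surviving.\<close>

lemma stem_flanks_branch_asm:
  assumes A: "A \<in> carrier_mat n n" "is_asm A" and conn: "cut_connected n A"
    and irred: "\<nexists>A'. attaches_D3 A' A \<and> cut_connected (n - 2) A'"
  shows "stem_flanks_branch n (\<lambda>i j. A $$ (i, j))"
  unfolding stem_flanks_branch_def
proof (intro allI impI)
  fix r c assume rc: "r < n" "c < n" "A $$ (r, c) = -1"
    and leaf: "\<forall>l<n. l \<noteq> c \<longrightarrow> A $$ (r, l) \<noteq> 0 \<longrightarrow> (\<forall>k<n. k \<noteq> r \<longrightarrow> A $$ (k, l) = 0)"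
  have alt: "alt_on {..<n} (\<lambda>j. A $$ (r, j))" "alt_on {..<n} (\<lambda>i. A $$ (i, c))"
    using A rc by (simp_all add: is_asm_iff_alt_on)
  obtain g h where g: "g < n" "g < c" "A $$ (r, g) = 1" and h: "h < n" "c < h" "A $$ (r, h) = 1"
    using alt_on_negative_neighbours[OF alt(1), of c] rc by (metis finite_lessThan lessThan_iff)
  obtain q s where q: "q < r" "A $$ (q, c) = 1" and s: "r < s" "s < n" "A $$ (s, c) = 1"
    and zero: "\<And>k. k < n \<Longrightarrow> q < k \<Longrightarrow> k < s \<Longrightarrow> k \<noteq> r \<Longrightarrow> A $$ (k, c) = 0"
    using alt_on_negative_neighbours[OF alt(2), of r] rc by (metis finite_lessThan lessThan_iff)
  \<comment> \<open>A column whose only nonzero entry is in row \<open>r\<close> has that entry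
    equal to its sum 1.\<close>
  have nonneg: "0 \<le> A $$ (r, l)" if l: "l < n" "l \<noteq> c" for l
  proof (cases "A $$ (r, l) = 0")
    case False
    then have "(\<Sum>i<n. A $$ (i, l)) = (\<Sum>i\<in>{r}. A $$ (i, l))"
      using leaf l rc by (intro sum.mono_neutral_right) auto
    then show ?thesis using asm_col_sum[OF A(2,1) l(1)] by simp
  qed simp
  \<comment> \<open>The entries in columns \<open>g\<close>, \<open>c\<close>, \<open>h\<close>
    already add up to the row sum 1; the remaining ones are nonnegative with sum 0, so row
    \<open>r\<close> has just three nonzero entries.\<close>
  let ?rest = "{..<n} - {g} - {c} - {h}"
  have "(\<Sum>l<n. A $$ (r, l)) = A $$ (r, g) + (A $$ (r, c) + (A $$ (r, h) + (\<Sum>l\<in>?rest. A $$ (r, l))))"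
    using g h rc by (subst sum.remove[of _ g], simp, simp, subst sum.remove[of _ c], simp, simp,
        subst sum.remove[of _ h]) auto
  then have "(\<Sum>l\<in>?rest. A $$ (r, l)) = 0"
    using asm_row_sum[OF A(2,1) rc(1)] g h rc by simp
  then have row_r: "A $$ (r, l) = 0" if "l < n" "l \<notin> {g, c, h}" for l
  proof -
    have "\<forall>l\<in>?rest. A $$ (r, l) = 0"
      using \<open>(\<Sum>l\<in>?rest. A $$ (r, l)) = 0\<close> nonneg by (subst sum_nonneg_eq_0_iff[symmetric]) auto
    then show ?thesis using that by blast
  qed
  have leaf_cols: "A $$ (k, g) = 0 \<and> A $$ (k, h) = 0" if "k < n" "k \<noteq> r" for k
    using leaf[rule_format, OF g(1) _ _ that] leaf[rule_format, OF h(1) _ _ that] g h by simp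
  have "\<exists>l<n. l \<noteq> c \<and> A $$ (s, l) \<noteq> 0"
  proof (rule ccontr)
    assume "\<not> ?thesis"
    then have "\<exists>A'. attaches_D3 A' A \<and> cut_connected (n - 2) A'"
      using remove_D3[OF A conn rc(1) _ s(2) g(2) h(2,1) _ rc(3) g(3) h(3) q(2) s(3) row_r leaf_cols]
        q s zero by fastforce
    then show False using irred by blast
  qed
  moreover have "\<exists>l<n. l \<noteq> c \<and> A $$ (q, l) \<noteq> 0"
  proof (rule ccontr)
    assume "\<not> ?thesis"
    then have "\<exists>A'. attaches_D3 A' A \<and> cut_connected (n - 2) A'"
      using remove_D3[OF A conn rc(1) s(2) _ g(2) h(2,1) _ rc(3) g(3) h(3) s(3) q(2) row_r leaf_cols]
        q s zero by fastforce
    then show False using irred by blast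
  qed
  ultimately show "\<exists>q s. q < r \<and> r < s \<and> s < n \<and> A $$ (q, c) = 1 \<and> A $$ (s, c) = 1 \<and>
        (\<forall>k. q < k \<longrightarrow> k < s \<longrightarrow> k \<noteq> r \<longrightarrow> A $$ (k, c) = 0) \<and>
        (\<exists>l<n. l \<noteq> c \<and> A $$ (q, l) \<noteq> 0) \<and> (\<exists>l<n. l \<noteq> c \<and> A $$ (s, l) \<noteq> 0)"
    using q s zero by - (rule exI[of _ q], rule exI[of _ s], auto)
qed

lemma stem_flanks_branch_transpose:
  assumes A: "A \<in> carrier_mat n n" "is_asm A" and conn: "cut_connected n A"
    and irred: "\<nexists>A'. attaches_D3 A' A \<and> cut_connected (n - 2) A'"
  shows "stem_flanks_branch n (\<lambda>i j. A $$ (j, i))"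
proof -
  have "\<nexists>A'. attaches_D3 A' (transpose_mat A) \<and> cut_connected (n - 2) A'"
  proof
    assume "\<exists>A'. attaches_D3 A' (transpose_mat A) \<and> cut_connected (n - 2) A'"
    then obtain A' where A': "attaches_D3 A' (transpose_mat A)" "cut_connected (n - 2) A'" by blast
    obtain m where m: "A' \<in> carrier_mat m m" "transpose_mat A \<in> carrier_mat (m + 2) (m + 2)"
      by (rule attaches_D3E[OF A'(1)])
    then have "n = m + 2" using A(1) by auto
    then have "cut_connected (n - 2) (transpose_mat A')"
      using cut_connected_transpose m(1) A'(2) by simp
    then show False using irred attaches_D3_transpose[OF A'(1)] by auto
  qed
  then have *: "stem_flanks_branch n (\<lambda>i j. transpose_mat A $$ (i, j))"
    using A conn is_asm_transpose cut_connected_transpose by (intro stem_flanks_branch_asm) auto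
  have At: "transpose_mat A $$ (i, j) = A $$ (j, i)" if "i < n" "j < n" for i j
    using that A(1) by auto
  show ?thesis
    unfolding stem_flanks_branch_def
  proof (intro allI impI)
    fix r c assume rc: "r < n" "c < n" "A $$ (c, r) = -1"
      and leaf: "\<forall>l<n. l \<noteq> c \<longrightarrow> A $$ (l, r) \<noteq> 0 \<longrightarrow> (\<forall>k<n. k \<noteq> r \<longrightarrow> A $$ (l, k) = 0)"
    have "\<exists>q s. q < r \<and> r < s \<and> s < n \<and> transpose_mat A $$ (q, c) = 1 \<and> transpose_mat A $$ (s, c) = 1 \<and>
        (\<forall>k. q < k \<longrightarrow> k < s \<longrightarrow> k \<noteq> r \<longrightarrow> transpose_mat A $$ (k, c) = 0) \<and>
        (\<exists>l<n. l \<noteq> c \<and> transpose_mat A $$ (q, l) \<noteq> 0) \<and> (\<exists>l<n. l \<noteq> c \<and> transpose_mat A $$ (s, l) \<noteq> 0)"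
    proof (rule *[unfolded stem_flanks_branch_def, THEN spec, THEN spec, THEN mp, THEN mp, THEN mp, THEN mp])
      show "transpose_mat A $$ (r, c) = -1" using At rc by simp
      show "\<forall>l<n. l \<noteq> c \<longrightarrow> transpose_mat A $$ (r, l) \<noteq> 0 \<longrightarrow>
          (\<forall>k<n. k \<noteq> r \<longrightarrow> transpose_mat A $$ (k, l) = 0)"
      proof (intro allI impI)
        fix l k assume l: "l < n" "l \<noteq> c" "transpose_mat A $$ (r, l) \<noteq> 0" and k: "k < n" "k \<noteq> r"
        have "A $$ (l, r) \<noteq> 0" using l(3) At[OF rc(1) l(1)] by simp
        then have "A $$ (l, k) = 0" using leaf l k by blast
        then show "transpose_mat A $$ (k, l) = 0" using At[OF k(1) l(1)] by simp
      qed
    qed (use rc in simp_all)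
    then obtain q s where qs: "q < r" "r < s" "s < n" and
      tr: "transpose_mat A $$ (q, c) = 1 \<and> transpose_mat A $$ (s, c) = 1 \<and>
        (\<forall>k. q < k \<longrightarrow> k < s \<longrightarrow> k \<noteq> r \<longrightarrow> transpose_mat A $$ (k, c) = 0) \<and>
        (\<exists>l<n. l \<noteq> c \<and> transpose_mat A $$ (q, l) \<noteq> 0) \<and> (\<exists>l<n. l \<noteq> c \<and> transpose_mat A $$ (s, l) \<noteq> 0)"
      by blast
    from qs have "q < n" by linarith
    show "\<exists>q s. q < r \<and> r < s \<and> s < n \<and> A $$ (c, q) = 1 \<and> A $$ (c, s) = 1 \<and>
        (\<forall>k. q < k \<longrightarrow> k < s \<longrightarrow> k \<noteq> r \<longrightarrow> A $$ (c, k) = 0) \<and>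
        (\<exists>l<n. l \<noteq> c \<and> A $$ (l, q) \<noteq> 0) \<and> (\<exists>l<n. l \<noteq> c \<and> A $$ (l, s) \<noteq> 0)"
    proof (rule exI[of _ q], rule exI[of _ s], intro conjI)
      show "A $$ (c, q) = 1" "A $$ (c, s) = 1" using tr At[OF _ rc(2)] \<open>q < n\<close> \<open>s < n\<close> by simp_all
      show "\<forall>k. q < k \<longrightarrow> k < s \<longrightarrow> k \<noteq> r \<longrightarrow> A $$ (c, k) = 0"
        using tr At[OF _ rc(2)] \<open>s < n\<close> by (metis order.strict_trans)
      show "\<exists>l<n. l \<noteq> c \<and> A $$ (l, q) \<noteq> 0" "\<exists>l<n. l \<noteq> c \<and> A $$ (l, s) \<noteq> 0"
        using tr At[OF \<open>q < n\<close>] At[OF \<open>s < n\<close>] by metis+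
    qed (use qs in simp_all)
  qed
qed

section \<open>What the linear order says about stems\<close>

context sign_graph
begin

text \<open>\<open>R\<close> and \<open>C\<close> embed the two kinds of lines as vertices.
  Instantiated both ways round, this treats stems at columns and stems at rows.\<close>

lemma pendant_stem_flanks:
  fixes R C :: "nat \<Rightarrow> 'v"
  assumes V: "V = R ` {..<n} \<union> C ` {..<n}" and inj: "inj R" "inj C" "\<And>i j. R i \<noteq> C j"
    and w: "\<And>i j. i < n \<Longrightarrow> j < n \<Longrightarrow> w (R i) (C j) = a i j" "\<And>i j. w (C i) (C j) = 0"
      "\<And>i j. w (R i) (R j) = 0"
    and flanks: "stem_flanks_branch n a" and stem: "pendant_stem (C c) v"
  obtains r q s where "v = R r" "q < r" "r < s" "s < n" "w (C c) (R q) = 1" "w (C c) (R s) = 1"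
    "\<And>k. q < k \<Longrightarrow> k < s \<Longrightarrow> k \<noteq> r \<Longrightarrow> w (C c) (R k) = 0" "R q \<in> inner" "R s \<in> inner"
proof -
  have wc: "w (C c) v = -1" using stem by (simp add: pendant_stem_def)
  then have Vs: "C c \<in> V" "v \<in> V" using w_supp[of "C c" v] w_supp'[of "C c" v] by auto
  have c: "c < n" 
  proof -
    have "C c \<notin> R ` {..<n}" using inj(3) by (metis imageE)
    then have "C c \<in> C ` {..<n}" using Vs(1) unfolding V by blast
    then show ?thesis using inj(2) by (auto simp: inj_eq)
  qed
  have "v \<noteq> C i" for i using wc w(2)[of c i] by auto
  then obtain r where r: "r < n" "v = R r" using Vs(2) unfolding V by blast
  have a_rc: "a r c = -1" using wc w(1)[OF r(1) c] w_sym r by metis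
  have only: "w x y' = 0" if x: "x \<in> leaves" and "w x y \<noteq> 0" "y' \<noteq> y" for x y y'
  proof -
    obtain z where "nbrs x = {z}" using x by (auto simp: leaves_def card_1_singleton_iff)
    then have "w x a \<noteq> 0 \<longleftrightarrow> a = z" for a unfolding nbrs_def by auto
    then show ?thesis using that by metis
  qed
  have leaf: "\<forall>l<n. l \<noteq> c \<longrightarrow> a r l \<noteq> 0 \<longrightarrow> (\<forall>k<n. k \<noteq> r \<longrightarrow> a k l = 0)"
  proof (intro allI impI)
    fix l k assume l: "l < n" "l \<noteq> c" "a r l \<noteq> 0" and k: "k < n" "k \<noteq> r"
    have "w (R r) (C l) \<noteq> 0" "C l \<noteq> C c" using l r w(1) inj by (auto simp: inj_eq)
    then have "C l \<in> leaves" "w (C l) (R r) \<noteq> 0"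
      using stem r w_sym unfolding pendant_stem_def by metis+
    then have "w (C l) (R k) = 0" using only[of "C l" "R r" "R k"] k inj by (auto simp: inj_eq)
    then show "a k l = 0" using w(1)[OF k(1) l(1)] w_sym by metis
  qed
  obtain q s where qs: "q < r" "r < s" "s < n" "a q c = 1" "a s c = 1"
    and zero: "\<And>k. q < k \<Longrightarrow> k < s \<Longrightarrow> k \<noteq> r \<Longrightarrow> a k c = 0"
    and ex: "\<exists>l<n. l \<noteq> c \<and> a q l \<noteq> 0" "\<exists>l<n. l \<noteq> c \<and> a s l \<noteq> 0"
    using flanks[unfolded stem_flanks_branch_def, THEN spec, THEN spec, THEN mp, THEN mp, THEN mp, THEN mp,
        OF r(1) c a_rc leaf] by blast
  have w': "w (C c) (R k) = a k c" if "k < n" for k using w(1)[OF that c] w_sym by metis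
  \<comment> \<open>A flanking line has a second nonzero entry, away from \<open>c\<close>, so it is
    not a leaf.\<close>
  have inner: "R k \<in> inner" if k: "k < n" "a k c = 1" and ex: "\<exists>l<n. l \<noteq> c \<and> a k l \<noteq> 0" for k
  proof -
    obtain l where l: "l < n" "l \<noteq> c" "a k l \<noteq> 0" using ex by blast
    have "R k \<notin> leaves"
      using only[of "R k" "C c" "C l"] l k w(1) c inj by (auto simp: inj_eq)
    moreover have "R k \<in> V" using k unfolding V by blast
    ultimately show ?thesis by (simp add: inner_def)
  qed
  show thesis
    by (rule that[of r q s]) (use qs zero w' inner ex r in auto)
qed

lemma one_stem_flanks:
  fixes R C :: "nat \<Rightarrow> 'v"
  assumes V: "V = R ` {..<n} \<union> C ` {..<n}" and inj: "inj R" "inj C" "\<And>i j. R i \<noteq> C j"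
    and w: "\<And>i j. i < n \<Longrightarrow> j < n \<Longrightarrow> w (R i) (C j) = a i j" "\<And>i j. w (C i) (C j) = 0"
      "\<And>i j. w (R i) (R j) = 0"
    and flanks: "stem_flanks_branch n a" and stem: "pendant_stem (C c) v"
  shows "2 \<le> card {y \<in> inner. w (C c) y = 1}"
proof -
  obtain r q s where qs: "q < r" "r < s" "w (C c) (R q) = 1" "w (C c) (R s) = 1" "R q \<in> inner" "R s \<in> inner"
    by (rule pendant_stem_flanks[OF assms])
  then have "R q \<noteq> R s" using inj by (auto simp: inj_eq)
  then have "card {R q, R s} = 2" by simp
  moreover have "{R q, R s} \<subseteq> {y \<in> inner. w (C c) y = 1}" using qs by auto
  moreover have "finite {y \<in> inner. w (C c) y = 1}" using finite_value_class[of 1 "C c"] by simp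
  ultimately show ?thesis using card_mono by metis
qed

text \<open>For stems at \<open>r1 < r2\<close>, the interval between the flanks of
  \<open>r1\<close> has no other nonzero entry, so the upper flank \<open>s1\<close> lies below
  \<open>r2\<close>. Then \<open>q1\<close>, \<open>s1\<close> and the upper flank of
  \<open>r2\<close> are three different lines.\<close>

lemma two_stems_flanks:
  fixes R C :: "nat \<Rightarrow> 'v"
  assumes V: "V = R ` {..<n} \<union> C ` {..<n}" and inj: "inj R" "inj C" "\<And>i j. R i \<noteq> C j"
    and w: "\<And>i j. i < n \<Longrightarrow> j < n \<Longrightarrow> w (R i) (C j) = a i j" "\<And>i j. w (C i) (C j) = 0"
      "\<And>i j. w (R i) (R j) = 0"
    and flanks: "stem_flanks_branch n a"
    and stems: "pendant_stem (C c) v" "pendant_stem (C c) v'" "v \<noteq> v'"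
  shows "3 \<le> card {y \<in> inner. w (C c) y = 1}"
proof -
  have main: "3 \<le> card {y \<in> inner. w (C c) y = 1}"
    if st: "pendant_stem (C c) (R r1)" "pendant_stem (C c) (R r2)" "r1 < r2" for r1 r2
  proof -
    obtain q1 s1 where 1: "q1 < r1" "r1 < s1" "w (C c) (R q1) = 1" "w (C c) (R s1) = 1"
      "R q1 \<in> inner" "R s1 \<in> inner"
      and zero: "\<And>k. q1 < k \<Longrightarrow> k < s1 \<Longrightarrow> k \<noteq> r1 \<Longrightarrow> w (C c) (R k) = 0"
      by (rule pendant_stem_flanks[OF V inj w flanks st(1)]) (use inj(1) in \<open>auto simp: inj_eq\<close>)
    obtain s2 where 2: "r2 < s2" "w (C c) (R s2) = 1" "R s2 \<in> inner"
      by (rule pendant_stem_flanks[OF V inj w flanks st(2)]) (use inj(1) in \<open>auto simp: inj_eq\<close>)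
    have wr2: "w (C c) (R r2) = -1" using st(2) by (simp add: pendant_stem_def)
    have "s1 \<noteq> r2" using wr2 1(4) by auto
    moreover have "\<not> r2 < s1" using zero[of r2] wr2 st(3) 1(1) by auto
    ultimately have "s1 < r2" by linarith
    then have "R q1 \<noteq> R s1" "R s1 \<noteq> R s2" "R q1 \<noteq> R s2" using 1 2 inj by (auto simp: inj_eq)
    then have "card {R q1, R s1, R s2} = 3" by simp
    moreover have "{R q1, R s1, R s2} \<subseteq> {y \<in> inner. w (C c) y = 1}" using 1 2 by auto
    moreover have "finite {y \<in> inner. w (C c) y = 1}" using finite_value_class[of 1 "C c"] by simp
    ultimately show ?thesis using card_mono by metis
  qed
  obtain r where r: "v = R r" by (rule pendant_stem_flanks[OF V inj w flanks stems(1)])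
  obtain r' where r': "v' = R r'" by (rule pendant_stem_flanks[OF V inj w flanks stems(2)])
  have "r \<noteq> r'" using stems(3) r r' by auto
  then show ?thesis using main[of r r'] main[of r' r] stems r r' by (metis linorder_neqE_nat)
qed

end

section \<open>The matrix as a signed graph\<close>

fun entry_weight :: "nat \<Rightarrow> int mat \<Rightarrow> bg_vertex \<Rightarrow> bg_vertex \<Rightarrow> int" where
  "entry_weight n A (Row i) (Col j) = (if i < n \<and> j < n then A $$ (i, j) else 0)"
| "entry_weight n A (Col j) (Row i) = (if i < n \<and> j < n then A $$ (i, j) else 0)"
| "entry_weight n A (Row i) (Row j) = 0"
| "entry_weight n A (Col i) (Col j) = 0"

fun is_row :: "bg_vertex \<Rightarrow> bool" where
  "is_row (Row i) = True"
| "is_row (Col j) = False"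

lemma entry_weight_bipartite: "entry_weight n A x y \<noteq> 0 \<Longrightarrow> is_row x \<noteq> is_row y"
  by (cases x; cases y) auto

lemma sign_graph_asm:
  assumes A: "A \<in> carrier_mat n n" "is_asm A"
  shows "sign_graph (Row ` {..<n} \<union> Col ` {..<n}) (entry_weight n A)"
proof
  show "finite (Row ` {..<n} \<union> Col ` {..<n})" by simp
  show sym: "entry_weight n A x y = entry_weight n A y x" for x y by (cases x; cases y) auto
  show "x \<in> Row ` {..<n} \<union> Col ` {..<n}" if "entry_weight n A x y \<noteq> 0" for x y
    using that by (cases x; cases y) (auto split: if_splits)
  show "entry_weight n A x y \<in> {-1, 0, 1}" for x y
    using asm_entry[OF A(2,1)] by (cases x; cases y) auto
  fix x assume x: "x \<in> Row ` {..<n} \<union> Col ` {..<n}"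
  have "(\<Sum>y\<in>Row ` {..<n} \<union> Col ` {..<n}. entry_weight n A x y) =
      (\<Sum>y\<in>Row ` {..<n}. entry_weight n A x y) + (\<Sum>y\<in>Col ` {..<n}. entry_weight n A x y)"
    by (rule sum.union_disjoint) auto
  also have "\<dots> = (\<Sum>i<n. entry_weight n A x (Row i)) + (\<Sum>j<n. entry_weight n A x (Col j))"
    by (simp add: sum.reindex inj_on_def)
  also have "\<dots> = 1"
    using x asm_row_sum[OF A(2,1)] asm_col_sum[OF A(2,1)] by (cases x) auto
  finally show "(\<Sum>y\<in>Row ` {..<n} \<union> Col ` {..<n}. entry_weight n A x y) = 1" .
qed

lemma card_entry_weight:
  assumes "A \<in> carrier_mat n n"
  shows "card {(x, y). entry_weight n A x y \<noteq> 0} = 2 * num_nonzero A"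
proof -
  let ?Z = "{(i, j). i < dim_row A \<and> j < dim_col A \<and> A $$ (i, j) \<noteq> 0}"
  let ?f = "\<lambda>(i, j). (Row i, Col j)" and ?g = "\<lambda>(i, j). (Col j, Row i)"
  have "{(x, y). entry_weight n A x y \<noteq> 0} = ?f ` ?Z \<union> ?g ` ?Z"
  proof (intro equalityI subsetI)
    fix e assume "e \<in> {(x, y). entry_weight n A x y \<noteq> 0}"
    then obtain x y where "e = (x, y)" "entry_weight n A x y \<noteq> 0" by auto
    then show "e \<in> ?f ` ?Z \<union> ?g ` ?Z"
      using assms by (cases x; cases y) (auto split: if_splits)
  qed (use assms in auto)
  moreover have "finite ?Z" by (rule finite_subset[of _ "{..<dim_row A} \<times> {..<dim_col A}"]) auto
  moreover have "card (?f ` ?Z) = card ?Z" "card (?g ` ?Z) = card ?Z"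
    by (intro card_image; auto simp: inj_on_def)+
  moreover have "?f ` ?Z \<inter> ?g ` ?Z = {}" by auto
  ultimately show ?thesis by (simp add: card_Un_disjoint num_nonzero_def)
qed

lemma BG_entry_weight:
  assumes "A \<in> carrier_mat n n"
  shows "BG A = \<lparr> sg_verts = Row ` {..<n} \<union> Col ` {..<n},
    pos_edges = {{x, y} | x y. entry_weight n A x y = 1},
    neg_edges = {{x, y} | x y. entry_weight n A x y = -1} \<rparr>"
proof -
  have "{{Row i, Col j} | i j. i < n \<and> j < n \<and> A $$ (i, j) = a} = {{x, y} | x y. entry_weight n A x y = a}"
    if a: "a \<noteq> 0" for a
  proof (intro equalityI subsetI)
    fix e assume "e \<in> {{Row i, Col j} | i j. i < n \<and> j < n \<and> A $$ (i, j) = a}"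
    then obtain i j where "e = {Row i, Col j}" "entry_weight n A (Row i) (Col j) = a" by auto
    then show "e \<in> {{x, y} | x y. entry_weight n A x y = a}" by blast
  next
    fix e assume "e \<in> {{x, y} | x y. entry_weight n A x y = a}"
    then obtain x y where e: "e = {x, y}" "entry_weight n A x y = a" by blast
    show "e \<in> {{Row i, Col j} | i j. i < n \<and> j < n \<and> A $$ (i, j) = a}"
      using e a by (cases x; cases y) (auto split: if_splits)
  qed
  then show ?thesis using assms by (simp add: BG_def)
qed

text \<open>The place where irreducibility of the matrix is turned into the graph hypotheses. Stems
  at columns use the order of the rows, stems at rows the order of the columns.\<close>

lemma irreducible_asm:
  assumes A: "A \<in> carrier_mat n n" "is_asm A" and conn: "cut_connected n A" and n: "2 \<le> n"
    and irred: "\<nexists>A'. attaches_D3 A' A \<and> cut_connected (n - 2) A'"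
  shows "2 * n \<le> num_nonzero A" "num_nonzero A = 2 * n \<Longrightarrow> basic_unicyclic_asm A"
proof -
  let ?V = "Row ` {..<n} \<union> Col ` {..<n}"
  interpret sign_graph ?V "entry_weight n A" by (rule sign_graph_asm[OF A])
  have "card ?V = card (Row ` {..<n}) + card (Col ` {..<n})" by (rule card_Un_disjoint) auto
  then have cardV: "card ?V = 2 * n" by (simp add: card_image inj_on_def)
  have graph_conn: "S = ?V" if S: "S \<noteq> {}" "S \<subseteq> ?V"
    "\<And>x y. x \<in> S \<Longrightarrow> entry_weight n A x y \<noteq> 0 \<Longrightarrow> y \<in> S" for S
  proof -
    have "(Row i \<in> S) = (Col j \<in> S)" if "i < n" "j < n" "A $$ (i, j) \<noteq> 0" for i j
      using S(3)[of "Row i" "Col j"] S(3)[of "Col j" "Row i"] that by auto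
    then obtain b where "\<And>i. i < n \<Longrightarrow> (Row i \<in> S) = b" "\<And>i. i < n \<Longrightarrow> (Col i \<in> S) = b"
      using cut_connectedD[OF conn, of "\<lambda>i. Row i \<in> S" "\<lambda>j. Col j \<in> S"] by blast
    then show ?thesis using S(1,2) by (cases b) auto
  qed
  have inj: "inj Row" "inj Col" "\<And>i j. Row i \<noteq> Col j" "\<And>i j. Col i \<noteq> Row j" by (auto simp: inj_def)
  note row_flanks = stem_flanks_branch_asm[OF A conn irred]
  note col_flanks = stem_flanks_branch_transpose[OF A conn irred]
  have V': "?V = Col ` {..<n} \<union> Row ` {..<n}" by blast
  have stem_V: "u \<in> ?V" if "pendant_stem u v" for u v
    using w_supp[of u v] that by (simp add: pendant_stem_def)
  interpret irreducible_sign_graph ?V "entry_weight n A"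
  proof
    have "Row 0 \<in> ?V" using n by auto
    then show "?V \<noteq> {}" by blast
    show "entry_weight n A x y = 0" if xy: "x \<in> leaves" "y \<in> leaves" for x y
    proof (rule ccontr)
      assume e: "entry_weight n A x y \<noteq> 0"
      have only: "z = y'" if x': "x' \<in> leaves" and "entry_weight n A x' z \<noteq> 0" "entry_weight n A x' y' \<noteq> 0" for x' y' z
      proof -
        obtain a where "nbrs x' = {a}" using x' by (auto simp: leaves_def card_1_singleton_iff)
        then have "entry_weight n A x' b \<noteq> 0 \<longleftrightarrow> b = a" for b unfolding nbrs_def by auto
        then show ?thesis using that by metis
      qed
      have e': "entry_weight n A y x \<noteq> 0" using e w_sym by metis
      \<comment> \<open>Two adjacent leaves form a component, hence by connectedness the whole
        graph, which has at least four vertices.\<close>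
      have "{x, y} = ?V"
        by (rule graph_conn) (use xy only[OF xy(1) _ e] only[OF xy(2) _ e'] in \<open>auto simp: leaves_def\<close>)
      then have "2 * n \<le> card {x, y}" using cardV by simp
      moreover have "card {x, y} \<le> 2" by (simp add: card_insert_if)
      ultimately show False using n by linarith
    qed
    show "2 \<le> card {y \<in> inner. entry_weight n A u y = 1}" if st: "pendant_stem u v" for u v
      using stem_V[OF st] st one_stem_flanks[OF refl inj(1,2,3) _ _ _ row_flanks]
        one_stem_flanks[OF V' inj(2,1,4) _ _ _ col_flanks] by auto
    show "3 \<le> card {y \<in> inner. entry_weight n A u y = 1}"
      if st: "pendant_stem u v" "pendant_stem u v'" "v \<noteq> v'" for u v v'
      using stem_V[OF st(1)] st two_stems_flanks[OF refl inj(1,2,3) _ _ _ row_flanks]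
        two_stems_flanks[OF V' inj(2,1,4) _ _ _ col_flanks] by auto
  qed
  show "2 * n \<le> num_nonzero A"
    using card_edges_ge cardV card_entry_weight[OF A(1)] by simp
  assume "num_nonzero A = 2 * n"
  then have "card {(x, y). entry_weight n A x y \<noteq> 0} = 2 * card ?V"
    using cardV card_entry_weight[OF A(1)] by simp
  then have "basic_unicyclic_graph (BG A)"
    unfolding BG_entry_weight[OF A(1)]
    by (rule basic_unicyclic[where side = is_row]) (rule graph_conn entry_weight_bipartite; assumption)+
  then show "basic_unicyclic_asm A" using A by (simp add: basic_unicyclic_asm_def)
qed

section \<open>Counting nonzero entries\<close>

lemma pendant_card:
  assumes "pendant k v W P N"
  shows "finite W" "finite (P \<union> N)" "card (P \<union> N) \<le> card W"
  using assms
proof (induction rule: pendant.induct)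
  case (both_positive w x y v)
  { case 1 show ?case by simp next
    case 2 show ?case by simp next
    case 3
    have "card ({{w, x}, {w, y}} \<union> {{v, w}}) \<le> 3"
      by (rule order_trans[OF card_Un_le]) (simp add: card_insert_if)
    then show ?case using both_positive by simp }
next
  case (one_positive v w)
  { case 1 show ?case by simp next case 2 show ?case by simp next case 3 show ?case by simp }
next
  case (both_negative x y z v)
  { case 1 show ?case by simp next
    case 2 show ?case by simp next
    case 3
    have "card ({{v, x}, {v, y}, {v, z}} \<union> {}) \<le> 3" by (simp add: card_insert_if)
    then show ?case using both_negative by simp }
qed

text \<open>Charge one cycle edge to each cycle vertex, and at most one edge to each added vertex.
  An upper bound suffices: equality comes from the lower bound for connected ASMs of even
  size.\<close>

lemma basic_unicyclic_graph_card:
  assumes "basic_unicyclic_graph G"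
  shows "finite (pos_edges G \<union> neg_edges G)" "card (pos_edges G \<union> neg_edges G) \<le> card (sg_verts G)"
proof -
  from assms obtain m vs CP CN W P N where dist: "distinct vs"
    and C: "CP \<union> CN = cycle_edges vs"
    and pend: "\<forall>v \<in> set vs. pendant (card {e \<in> CP. v \<in> e}) v (W v) (P v) (N v)"
    and new: "\<forall>v \<in> set vs. W v \<inter> set vs = {}"
      "\<forall>u \<in> set vs. \<forall>v \<in> set vs. u \<noteq> v \<longrightarrow> W u \<inter> W v = {}"
    and G: "sg_verts G = set vs \<union> (\<Union>v \<in> set vs. W v)"
      "pos_edges G = CP \<union> (\<Union>v \<in> set vs. P v)"
      "neg_edges G = CN \<union> (\<Union>v \<in> set vs. N v)"
    unfolding basic_unicyclic_graph_def by (elim exE conjE) (rule that)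
  have pc: "finite (W v)" "finite (P v \<union> N v)" "card (P v \<union> N v) \<le> card (W v)" if "v \<in> set vs" for v
    using pendant_card[OF pend[rule_format, OF that]] by auto
  have "cycle_edges vs = (\<lambda>i. {vs ! i, vs ! (Suc i mod length vs)}) ` {..<length vs}"
    by (auto simp: cycle_edges_def)
  then have cyc: "finite (cycle_edges vs)" "card (cycle_edges vs) \<le> length vs"
    using card_image_le[of "{..<length vs}"] by auto
  have edges: "pos_edges G \<union> neg_edges G = cycle_edges vs \<union> (\<Union>v \<in> set vs. P v \<union> N v)"
    by (simp add: G C[symmetric] UN_Un_distrib Un_ac)
  then show "finite (pos_edges G \<union> neg_edges G)" using cyc pc by auto
  have "card (pos_edges G \<union> neg_edges G) \<le> card (cycle_edges vs) + card (\<Union>v \<in> set vs. P v \<union> N v)"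
    unfolding edges by (rule card_Un_le)
  also have "\<dots> \<le> length vs + (\<Sum>v \<in> set vs. card (P v \<union> N v))"
    by (intro add_mono cyc(2) card_UN_le) simp
  also have "\<dots> \<le> length vs + (\<Sum>v \<in> set vs. card (W v))"
    by (intro add_left_mono sum_mono pc)
  also have "\<dots> = card (set vs) + card (\<Union>v \<in> set vs. W v)"
    using dist pc new by (simp add: distinct_card card_UN_disjoint)
  also have "\<dots> = card (sg_verts G)"
    unfolding G using pc new by (intro card_Un_disjoint[symmetric]) auto
  finally show "card (pos_edges G \<union> neg_edges G) \<le> card (sg_verts G)" .
qed

lemma basic_unicyclic_asm_num_nonzero:
  assumes "basic_unicyclic_asm A" "A \<in> carrier_mat n n"
  shows "num_nonzero A \<le> 2 * n"
proof -
  let ?Z = "{(i, j). i < dim_row A \<and> j < dim_col A \<and> A $$ (i, j) \<noteq> 0}"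
  let ?E = "pos_edges (BG A) \<union> neg_edges (BG A)"
  have asm: "is_asm A" "basic_unicyclic_graph (BG A)" using assms(1) by (simp_all add: basic_unicyclic_asm_def)
  have "(\<lambda>(i, j). {Row i, Col j}) ` ?Z \<subseteq> ?E"
  proof
    fix e assume "e \<in> (\<lambda>(i, j). {Row i, Col j}) ` ?Z"
    then obtain i j where ij: "e = {Row i, Col j}" "i < n" "j < n" "A $$ (i, j) \<noteq> 0"
      using assms(2) by auto
    then have "A $$ (i, j) = 1 \<or> A $$ (i, j) = -1" using asm_entry[OF asm(1) assms(2), of i j] by auto
    then show "e \<in> ?E" using ij assms(2) by (auto simp: BG_def)
  qed
  moreover have "inj_on (\<lambda>(i, j). {Row i, Col j}) ?Z" by (auto simp: inj_on_def doubleton_eq_iff)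
  ultimately have "num_nonzero A \<le> card ?E"
    unfolding num_nonzero_def using basic_unicyclic_graph_card(1)[OF asm(2)]
    by (intro card_inj_on_le)
  also have "\<dots> \<le> card (sg_verts (BG A))" by (rule basic_unicyclic_graph_card(2)[OF asm(2)])
  also have "sg_verts (BG A) = Row ` {..<n} \<union> Col ` {..<n}" using assms(2) by (simp add: BG_def)
  also have "card \<dots> = card (Row ` {..<n}) + card (Col ` {..<n})" by (rule card_Un_disjoint) auto
  also have "\<dots> = 2 * n" by (simp add: card_image inj_on_def)
  finally show ?thesis .
qed

text \<open>Invariance of the excess, written without subtraction because it may be
  negative.\<close>

lemma attaches_D3s_num_nonzero:
  assumes "attaches_D3s A B" "A \<in> carrier_mat m m"
  shows "\<exists>n. B \<in> carrier_mat n n \<and> num_nonzero B + 2 * m = num_nonzero A + 2 * n"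
  using assms(1)
proof (induction rule: rtranclp_induct)
  case base
  then show ?case using assms(2) by blast
next
  case (step B C)
  then obtain n where n: "B \<in> carrier_mat n n" "num_nonzero B + 2 * m = num_nonzero A + 2 * n"
    by blast
  obtain k where k: "B \<in> carrier_mat k k" "C \<in> carrier_mat (k + 2) (k + 2)"
    "num_nonzero C = num_nonzero B + 4"
    by (rule attaches_D3E[OF step(2)])
  have "k = n" using n(1) k(1) by auto
  then show ?case using n(2) k by (intro exI[of _ "n + 2"]) simp
qed

text \<open>Squaring sends the entries -1, 0, 1 to 0 and 1, which turns the count into a sum that
  can be split by rows.\<close>

lemma num_nonzero_sum_squares:
  assumes "A \<in> carrier_mat n n" "is_asm A"
  shows "int (num_nonzero A) = (\<Sum>i<n. \<Sum>j<n. (A $$ (i, j))\<^sup>2)"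
proof -
  let ?Z = "{(i, j). i < dim_row A \<and> j < dim_col A \<and> A $$ (i, j) \<noteq> 0}"
  have "int (num_nonzero A) = (\<Sum>e\<in>?Z. 1)" by (simp add: num_nonzero_def)
  also have "\<dots> = (\<Sum>(i, j)\<in>?Z. (A $$ (i, j))\<^sup>2)"
  proof (rule sum.cong)
    fix e assume "e \<in> ?Z"
    then obtain i j where e: "e = (i, j)" "i < n" "j < n" "A $$ (i, j) \<noteq> 0" using assms(1) by auto
    then have "A $$ (i, j) = 1 \<or> A $$ (i, j) = -1" using asm_entry[OF assms(2,1), of i j] by auto
    then show "1 = (case e of (i, j) \<Rightarrow> (A $$ (i, j))\<^sup>2)" using e by auto
  qed simp
  also have "\<dots> = (\<Sum>(i, j)\<in>{..<n} \<times> {..<n}. (A $$ (i, j))\<^sup>2)"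
    using assms(1) by (intro sum.mono_neutral_left) auto
  finally show ?thesis by (simp add: sum.cartesian_product)
qed

text \<open>\<open>x\<^sup>2 - x\<close> is even for every integer \<open>x\<close>, and the entries
  of the matrix sum to \<open>n\<close>.\<close>

lemma num_nonzero_parity:
  assumes "A \<in> carrier_mat n n" "is_asm A"
  shows "even (num_nonzero A) \<longleftrightarrow> even n"
proof -
  have "(\<Sum>i<n. \<Sum>j<n. A $$ (i, j)) = int n" using asm_row_sum[OF assms(2,1)] by simp
  then have "int (num_nonzero A) - int n = (\<Sum>i<n. \<Sum>j<n. (A $$ (i, j))\<^sup>2 - A $$ (i, j))"
    unfolding num_nonzero_sum_squares[OF assms] by (simp add: sum_subtractf)
  moreover have "even (\<Sum>i<n. \<Sum>j<n. (A $$ (i, j))\<^sup>2 - A $$ (i, j))"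
    by (intro dvd_sum) simp
  ultimately have "even (int (num_nonzero A) - int n)" by simp
  then show ?thesis by simp
qed

section \<open>Decomposition of connected ASMs by induction on the size\<close>

lemma asm_dim_1:
  assumes "A \<in> carrier_mat 1 1" "is_asm A"
  shows "A = 1\<^sub>m 1"
proof (rule eq_matI)
  fix i j assume "i < dim_row (1\<^sub>m 1 :: int mat)" "j < dim_col (1\<^sub>m 1 :: int mat)"
  then have "i = 0" "j = 0" by auto
  then show "A $$ (i, j) = 1\<^sub>m 1 $$ (i, j)" using asm_row_sum[OF assms(2,1), of 0] by simp
qed (use assms(1) in auto)

lemma num_nonzero_one: "num_nonzero (1\<^sub>m 1) = 1"
proof -
  have "{(i, j). i < dim_row (1\<^sub>m 1 :: int mat) \<and> j < dim_col (1\<^sub>m 1 :: int mat) \<and> 1\<^sub>m 1 $$ (i, j) \<noteq> (0::int)}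
    = {(0, 0)}" by auto
  then show ?thesis by (simp add: num_nonzero_def)
qed

text \<open>All three claims speak of the excess, which a removal preserves, so they descend
  together. At an irreducible matrix of size at least 2 the count is at least \<open>2 * n\<close>:
  the second claim is void there, and in the third the matrix itself serves as
  \<open>B\<close>.\<close>

lemma connected_asm_decomposition:
  assumes "A \<in> carrier_mat n n" "is_asm A" "cut_connected n A" "0 < n"
  shows "2 * n - 1 \<le> num_nonzero A"
    "num_nonzero A = 2 * n - 1 \<Longrightarrow> attaches_D3s (1\<^sub>m 1) A"
    "num_nonzero A = 2 * n \<Longrightarrow> \<exists>B. basic_unicyclic_asm B \<and> attaches_D3s B A"
proof -
  have "2 * n - 1 \<le> num_nonzero A \<and> (num_nonzero A = 2 * n - 1 \<longrightarrow> attaches_D3s (1\<^sub>m 1) A) \<and>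
    (num_nonzero A = 2 * n \<longrightarrow> (\<exists>B. basic_unicyclic_asm B \<and> attaches_D3s B A))"
    using assms
  proof (induction n arbitrary: A rule: less_induct)
    case (less n)
    note A = less.prems(1-3)
    consider "n = 1" | "2 \<le> n" "\<exists>A'. attaches_D3 A' A \<and> cut_connected (n - 2) A'"
      | "2 \<le> n" "\<nexists>A'. attaches_D3 A' A \<and> cut_connected (n - 2) A'"
    proof -
      have "n = 1 \<or> 2 \<le> n" using less.prems(4) by linarith
      then show thesis using that by blast
    qed
    then show ?case
    proof cases
      case 1
      then have "A = 1\<^sub>m 1" using asm_dim_1 A by simp
      then show ?thesis using num_nonzero_one 1 by simp
    next
      case 2
      then obtain A' where A': "attaches_D3 A' A" "cut_connected (n - 2) A'" by blast
      obtain m where m: "0 < m" "A' \<in> carrier_mat m m" "A \<in> carrier_mat (m + 2) (m + 2)" "is_asm A'"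
        "num_nonzero A = num_nonzero A' + 4"
        by (rule attaches_D3E[OF A'(1)])
      then have n: "n = m + 2" using A(1) by auto
      have "2 * m - 1 \<le> num_nonzero A' \<and> (num_nonzero A' = 2 * m - 1 \<longrightarrow> attaches_D3s (1\<^sub>m 1) A') \<and>
          (num_nonzero A' = 2 * m \<longrightarrow> (\<exists>B. basic_unicyclic_asm B \<and> attaches_D3s B A'))"
        using less.IH[of m A'] m A'(2) n by simp
      then show ?thesis
        using m(1,5) n rtranclp.rtrancl_into_rtrancl[of attaches_D3 _ A' A, OF _ A'(1)] by auto
    next
      case 3
      then show ?thesis using irreducible_asm[OF A 3] by auto
    qed
  qed
  then show "2 * n - 1 \<le> num_nonzero A"
    "num_nonzero A = 2 * n - 1 \<Longrightarrow> attaches_D3s (1\<^sub>m 1) A"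
    "num_nonzero A = 2 * n \<Longrightarrow> \<exists>B. basic_unicyclic_asm B \<and> attaches_D3s B A" by blast+
qed

section \<open>Existence of matrices attaining the minimum\<close>

lemma extend_connected_asm:
  assumes A: "A \<in> carrier_mat n n" "is_asm A" "cut_connected n A" "0 < n"
  shows "\<exists>B \<in> carrier_mat (n + 2) (n + 2). is_asm B \<and> cut_connected (n + 2) B \<and>
    num_nonzero B = num_nonzero A + 4"
proof -
  \<comment> \<open>The new rows go below \<open>A\<close>, the new columns on its left and right; \<open>D3\<close> hangs on column 0 of \<open>A\<close>.\<close>
  define B where "B = mat (n + 2) (n + 2) (\<lambda>(i, j).
    if i < n then (if 0 < j \<and> j \<le> n then A $$ (i, j - 1) else 0)
    else if i = n then (if j = 0 \<or> j = n + 1 then 1 else if j = 1 then -1 else 0)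
    else if j = 1 then 1 else 0)"
  have B: "B \<in> carrier_mat (n + 2) (n + 2)" by (simp add: B_def)
  have top: "B $$ (i, j) = (if 0 < j \<and> j \<le> n then A $$ (i, j - 1) else 0)" if "i < n" "j < n + 2" for i j
    using that by (simp add: B_def)
  have mid: "B $$ (n, j) = (if j = 0 \<or> j = n + 1 then 1 else if j = 1 then -1 else 0)" if "j < n + 2" for j
    using that by (simp add: B_def)
  have bot: "B $$ (n + 1, j) = (if j = 1 then 1 else 0)" if "j < n + 2" for j
    using that by (simp add: B_def)
  have asm: "is_asm B"
    unfolding is_asm_iff_alt_on[OF B]
  proof (intro conjI allI impI)
    fix i assume "i < n + 2"
    then consider "i < n" | "i = n" | "i = n + 1" by linarith
    then show "alt_on {..<n + 2} (\<lambda>j. B $$ (i, j))"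
    proof cases
      case 1
      have "alt_on {..<n} (\<lambda>j. A $$ (i, j))" using A 1 by (simp add: is_asm_iff_alt_on)
      then have "alt_on {..<n} (\<lambda>j. B $$ (i, Suc j))"
        using top[OF 1] by (simp cong: alt_on_cong)
      then have "alt_on (Suc ` {..<n}) (\<lambda>j. B $$ (i, j))"
        using alt_on_reindex[of "{..<n}" Suc "\<lambda>j. B $$ (i, j)"] by (simp add: strict_mono_on_def)
      moreover have "B $$ (i, j) = 0" if "j \<in> {..<n + 2} - Suc ` {..<n}" for j
      proof -
        have "j = 0 \<or> n < j"
        proof (rule ccontr)
          assume "\<not> ?thesis"
          then have "j = Suc (j - 1)" "j - 1 < n" by auto
          then show False using that by blast
        qed
        then show ?thesis using that top[OF 1] by auto
      qed
      moreover have "Suc ` {..<n} \<subseteq> {..<n + 2}" by auto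
      ultimately show ?thesis
        using alt_on_remove_zeros[of "{..<n + 2}" "Suc ` {..<n}" "\<lambda>j. B $$ (i, j)"] by blast
    next
      case 2
      have "alt_on {0, 1, n + 1} (\<lambda>j. B $$ (i, j))"
        using A(4) mid 2 by (intro alt_on_triple) auto
      then show ?thesis
        using 2 mid by (subst alt_on_remove_zeros[of "{..<n + 2}" "{0, 1, n + 1}", symmetric]) auto
    next
      case 3
      have "alt_on {1} (\<lambda>j. B $$ (i, j))" using bot[of 1] 3 by (intro alt_on_singleton) simp
      then show ?thesis
        using 3 bot by (subst alt_on_remove_zeros[of "{..<n + 2}" "{1}", symmetric]) auto
    qed
  next
    fix j assume j: "j < n + 2"
    have split: "i < n \<or> i = n \<or> i = n + 1" if "i < n + 2" for i using that by linarith
    consider "j = 0 \<or> j = n + 1" | "j = 1" | "1 < j" "j \<le> n" using j by linarith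
    then show "alt_on {..<n + 2} (\<lambda>i. B $$ (i, j))"
    proof cases
      case 1
      then have j1: "j \<noteq> 1" using A(4) by auto
      have "alt_on {n} (\<lambda>i. B $$ (i, j))" using mid[of j] j 1 by (intro alt_on_singleton) auto
      moreover have "B $$ (i, j) = 0" if "i \<in> {..<n + 2} - {n}" for i
        using split[of i] that top[of i j] bot[of j] 1 j1 j by auto
      ultimately show ?thesis
        using alt_on_remove_zeros[of "{..<n + 2}" "{n}"] by simp
    next
      \<comment> \<open>Column 1 is column 0 of \<open>A\<close>, whose sum is 1, continued below by
        -1 and +1.\<close>
      case 2
      have "alt_on {..<n} (\<lambda>i. A $$ (i, 0))" using A by (simp add: is_asm_iff_alt_on)
      then have "alt_on {..<n} (\<lambda>i. B $$ (i, j))"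
        using top[of _ 1] 2 A(4) by (simp cong: alt_on_cong)
      then have "alt_on ({..<n} \<union> {n, n + 1}) (\<lambda>i. B $$ (i, j))"
        using 2 mid[of 1] bot[of 1] A(4) by (intro alt_on_insert_after) auto
      moreover have "{..<n} \<union> {n, n + 1} = {..<n + 2}" by auto
      ultimately show ?thesis by simp
    next
      case 3
      have "alt_on {..<n} (\<lambda>i. A $$ (i, j - 1))" using A 3 by (simp add: is_asm_iff_alt_on)
      then have "alt_on {..<n} (\<lambda>i. B $$ (i, j))"
        using top[of _ j] 3 j by (simp cong: alt_on_cong)
      moreover have "B $$ (i, j) = 0" if "i \<in> {..<n + 2} - {..<n}" for i
        using split[of i] that mid[of j] bot[of j] 3 j by auto
      ultimately show ?thesis
        using alt_on_remove_zeros[of "{..<n + 2}" "{..<n}"] by auto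
    qed
  qed
  have conn: "cut_connected (n + 2) B"
    unfolding cut_connected_def
  proof (intro allI impI)
    fix P Q :: "nat \<Rightarrow> bool"
    assume PQ: "\<forall>i<n + 2. \<forall>j<n + 2. B $$ (i, j) \<noteq> 0 \<longrightarrow> P i = Q j"
    have "P i = Q (Suc j)" if "i < n" "j < n" "A $$ (i, j) \<noteq> 0" for i j
      using PQ[rule_format, of i "Suc j"] that top[of i "Suc j"] by simp
    then obtain b where b: "\<And>i. i < n \<Longrightarrow> P i = b" "\<And>i. i < n \<Longrightarrow> Q (Suc i) = b"
      using cut_connectedD[OF A(3), of P "\<lambda>j. Q (Suc j)"] by blast
    have Q1: "Q 1 = b" using b(2)[OF A(4)] by simp
    have "P n = Q 0" "P n = Q 1" "P n = Q (n + 1)" "P (n + 1) = Q 1"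
      using PQ[rule_format, of n 0] PQ[rule_format, of n 1] PQ[rule_format, of n "n + 1"]
        PQ[rule_format, of "n + 1" 1] mid[of 0] mid[of 1] mid[of "n + 1"] bot[of 1] A(4) by auto
    then have new: "P n = b" "P (n + 1) = b" "Q 0 = b" "Q (n + 1) = b" using Q1 by auto
    have "P i = b \<and> Q i = b" if "i < n + 2" for i
    proof -
      have "i < n \<or> i = n \<or> i = n + 1" "i = 0 \<or> i = n + 1 \<or> i = Suc (i - 1) \<and> i - 1 < n"
        using that by linarith+
      then show ?thesis using b new by metis
    qed
    then show "\<exists>b. \<forall>i<n + 2. P i = b \<and> Q i = b" by blast
  qed
  have "num_nonzero B = num_nonzero A + 4"
  proof -
    have row: "(\<Sum>j<n + 2. (B $$ (i, j))\<^sup>2) = (\<Sum>j<n. (A $$ (i, j))\<^sup>2)" if "i < n" for i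
    proof -
      have "(\<Sum>j<n + 2. (B $$ (i, j))\<^sup>2) = (B $$ (i, 0))\<^sup>2 + (\<Sum>j<n. (B $$ (i, Suc j))\<^sup>2) + (B $$ (i, n + 1))\<^sup>2"
        using sum.lessThan_Suc_shift[of "\<lambda>j. (B $$ (i, j))\<^sup>2" n] by simp
      then show ?thesis using top[OF that] by simp
    qed
    have mid_sum: "(\<Sum>j<n + 2. (B $$ (n, j))\<^sup>2) = 3"
    proof -
      have "(\<Sum>j<n + 2. (B $$ (n, j))\<^sup>2) = (\<Sum>j\<in>{0, 1, n + 1}. (B $$ (n, j))\<^sup>2)"
        using mid by (intro sum.mono_neutral_right) auto
      then show ?thesis using mid A(4) by simp
    qed
    have bot_sum: "(\<Sum>j<n + 2. (B $$ (n + 1, j))\<^sup>2) = 1"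
    proof -
      have "(\<Sum>j<n + 2. (B $$ (n + 1, j))\<^sup>2) = (\<Sum>j\<in>{1}. (B $$ (n + 1, j))\<^sup>2)"
        using bot by (intro sum.mono_neutral_right) auto
      then show ?thesis using bot A(4) by simp
    qed
    have "(\<Sum>i<n + 2. \<Sum>j<n + 2. (B $$ (i, j))\<^sup>2) =
        (\<Sum>i<n. \<Sum>j<n + 2. (B $$ (i, j))\<^sup>2) + (\<Sum>j<n + 2. (B $$ (n, j))\<^sup>2) + (\<Sum>j<n + 2. (B $$ (n + 1, j))\<^sup>2)"
      by simp
    also have "\<dots> = (\<Sum>i<n. \<Sum>j<n. (A $$ (i, j))\<^sup>2) + 4"
      unfolding mid_sum bot_sum using row by simp
    finally have "int (num_nonzero B) = int (num_nonzero A) + 4"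
      using num_nonzero_sum_squares[OF B asm] num_nonzero_sum_squares[OF A(1,2)] by simp
    then show ?thesis by simp
  qed
  then show ?thesis using B asm conn by blast
qed

text \<open>The witness is symmetric and tridiagonal, and it is basic unicyclic: its middle 2 by 2
  block is a 4-cycle with alternating signs, and each cycle vertex carries one positive
  leaf.\<close>

lemma connected_asm_dim_4:
  "\<exists>A \<in> carrier_mat 4 4. is_asm A \<and> cut_connected 4 A \<and> num_nonzero A = 8"
proof -
  define A :: "int mat" where "A = mat 4 4 (\<lambda>(i, j).
    if i = j then (if i = 1 \<or> i = 2 then -1 else 0) else if Suc i = j \<or> Suc j = i then 1 else 0)"
  have A: "A \<in> carrier_mat 4 4" by (simp add: A_def)
  have entry: "A $$ (i, j) =
    (if i = j then (if i = 1 \<or> i = 2 then -1 else 0) else if Suc i = j \<or> Suc j = i then 1 else 0)"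
    if "i < 4" "j < 4" for i j using that by (simp add: A_def)
  have sym: "A $$ (i, j) = A $$ (j, i)" if "i < 4" "j < 4" for i j using that entry by auto
  have row: "alt_on {..<4} (\<lambda>j. A $$ (i, j))" if i4: "i < 4" for i
  proof -
    have "i = 0 \<or> i = 1 \<or> i = 2 \<or> i = 3" using i4 by linarith
    then consider "i = 0 \<or> i = 3" | "i = 1 \<or> i = 2" by blast
    then show ?thesis
    proof cases
      case 1
      define a :: nat where "a = (if i = 0 then 1 else 2)"
      have "alt_on {a} (\<lambda>j. A $$ (i, j))"
        using 1 entry[of i a] by (intro alt_on_singleton) (auto simp: a_def)
      moreover have "A $$ (i, j) = 0" if "j \<in> {..<4} - {a}" for j
        using that entry[of i j] 1 by (auto simp: a_def split: if_splits)
      ultimately show ?thesis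
        using alt_on_remove_zeros[of "{..<4}" "{a}"] 1 by (auto simp: a_def)
    next
      case 2
      have "alt_on {i - 1, i, i + 1} (\<lambda>j. A $$ (i, j))"
        using 2 by (intro alt_on_triple) (auto simp: entry)
      moreover have "A $$ (i, j) = 0" if "j \<in> {..<4} - {i - 1, i, i + 1}" for j
        using that entry[of i j] 2 by auto
      ultimately show ?thesis
        using alt_on_remove_zeros[of "{..<4}" "{i - 1, i, i + 1}"] 2 by auto
    qed
  qed
  have col: "alt_on {..<4} (\<lambda>i. A $$ (i, j))" if "j < 4" for j
    using row[OF that] sym[OF that] by (simp cong: alt_on_cong)
  have asm: "is_asm A" using row col by (simp add: is_asm_iff_alt_on[OF A])
  have "cut_connected 4 A"
    unfolding cut_connected_def
  proof (intro allI impI)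
    fix P Q :: "nat \<Rightarrow> bool" assume PQ: "\<forall>i<4. \<forall>j<4. A $$ (i, j) \<noteq> 0 \<longrightarrow> P i = Q j"
    have "P 0 = Q 1" "P 1 = Q 0" "P 1 = Q 1" "P 1 = Q 2" "P 2 = Q 2" "P 2 = Q 3" "P 3 = Q 2"
      by (rule PQ[rule_format]; simp add: entry)+
    then have *: "P i = P 0 \<and> Q i = P 0" if "i = 0 \<or> i = 1 \<or> i = 2 \<or> i = 3" for i
      using that by (elim disjE) simp_all
    have "P i = P 0 \<and> Q i = P 0" if "i < 4" for i
    proof -
      have "i = 0 \<or> i = 1 \<or> i = 2 \<or> i = 3" using that by linarith
      then show ?thesis by (rule *)
    qed
    then have "\<forall>i<4. P i = P 0 \<and> Q i = P 0" by blast
    then show "\<exists>b. \<forall>i<4. P i = b \<and> Q i = b" by (rule exI)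
  qed
  moreover have "num_nonzero A = 8"
  proof -
    have four: "{..<4::nat} = {0, 1, 2, 3}" by auto
    have "int (num_nonzero A) = 8"
      unfolding num_nonzero_sum_squares[OF A asm] four by (simp add: entry)
    then show ?thesis by simp
  qed
  ultimately show ?thesis using A asm by blast
qed

lemma connected_asm_exists:
  assumes "n \<ge> 1" "n \<noteq> 2"
  shows "\<exists>A \<in> carrier_mat n n. is_asm A \<and> cut_connected n A \<and>
    num_nonzero A = (if odd n then 2 * n - 1 else 2 * n)"
proof -
  \<comment> \<open>Steps of size 2 keep the excess, so one seed for each parity is enough: size 1
    with excess -1 and size 4 with excess 0.\<close>
  have extend: "\<exists>A \<in> carrier_mat (m + 2 * t) (m + 2 * t). is_asm A \<and> cut_connected (m + 2 * t) A \<and>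
      num_nonzero A = k + 4 * t"
    if "\<exists>A \<in> carrier_mat m m. is_asm A \<and> cut_connected m A \<and> num_nonzero A = k" "0 < m" for m k t
  proof (induction t)
    case (Suc t)
    then obtain A where "A \<in> carrier_mat (m + 2 * t) (m + 2 * t)" "is_asm A" "cut_connected (m + 2 * t) A"
      "num_nonzero A = k + 4 * t" by blast
    then have "\<exists>B \<in> carrier_mat (m + 2 * t + 2) (m + 2 * t + 2). is_asm B \<and>
        cut_connected (m + 2 * t + 2) B \<and> num_nonzero B = (k + 4 * t) + 4"
      using extend_connected_asm[of A "m + 2 * t"] that(2) by simp
    moreover have "m + 2 * t + 2 = m + 2 * Suc t" "(k + 4 * t) + 4 = k + 4 * Suc t" by simp_all
    ultimately show ?case by metis
  qed (use that in simp)
  show ?thesis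
  proof (cases "odd n")
    case True
    have one: "1\<^sub>m 1 \<in> carrier_mat 1 1" "is_asm (1\<^sub>m 1)" "cut_connected 1 (1\<^sub>m 1)"
    proof -
      show "1\<^sub>m 1 \<in> carrier_mat 1 1" by simp
      show "is_asm (1\<^sub>m 1)"
        using alt_on_singleton[of "\<lambda>_. 1" 0]
        by (subst is_asm_iff_alt_on[of _ 1]) (simp_all add: lessThan_Suc cong: alt_on_cong)
      show "cut_connected 1 (1\<^sub>m 1)" by (auto simp: cut_connected_def)
    qed
    obtain t where t: "n = 1 + 2 * t" using True by (metis oddE add.commute)
    have "\<exists>A \<in> carrier_mat (1 + 2 * t) (1 + 2 * t). is_asm A \<and> cut_connected (1 + 2 * t) A \<and>
        num_nonzero A = 1 + 4 * t"
      using one num_nonzero_one by (intro extend) auto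
    moreover have "1 + 4 * t = 2 * (1 + 2 * t) - 1" by simp
    ultimately show ?thesis using True unfolding t by metis
  next
    case False
    then have "4 \<le> n" using assms by (cases "n = 3") auto
    then obtain t where t: "n = 4 + 2 * t" using False by (metis even_add even_numeral evenE le_Suc_ex)
    have "\<exists>A \<in> carrier_mat (4 + 2 * t) (4 + 2 * t). is_asm A \<and> cut_connected (4 + 2 * t) A \<and>
        num_nonzero A = 8 + 4 * t"
      using connected_asm_dim_4 by (intro extend) auto
    moreover have "8 + 4 * t = 2 * (4 + 2 * t)" by simp
    ultimately show ?thesis using False unfolding t by metis
  qed
qed

theorem theorem3p1:
  fixes n :: nat
  assumes "n \<ge> 1" and "n \<noteq> 2"
  shows
    "((\<exists>A \<in> carrier_mat n n. connected_asm A \<and>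
         num_nonzero A = (if odd n then 2 * n - 1 else 2 * n)) \<and>
      (\<forall>A \<in> carrier_mat n n. connected_asm A \<longrightarrow>
         (if odd n then 2 * n - 1 else 2 * n) \<le> num_nonzero A)) \<and>
     (odd n \<longrightarrow> (\<forall>A \<in> carrier_mat n n. connected_asm A \<longrightarrow>
        (num_nonzero A = 2 * n - 1 \<longleftrightarrow> A = 1\<^sub>m 1 \<or> attaches_D3s (1\<^sub>m 1) A))) \<and>
     (even n \<longrightarrow> (\<forall>A \<in> carrier_mat n n. connected_asm A \<longrightarrow>
        (num_nonzero A = 2 * n \<longleftrightarrow>
           basic_unicyclic_asm A \<or> (\<exists>B. basic_unicyclic_asm B \<and> attaches_D3s B A))))"
proof -
  have n: "0 < n" using assms(1) by simp
  have ex: "\<exists>A \<in> carrier_mat n n. connected_asm A \<and> num_nonzero A = (if odd n then 2 * n - 1 else 2 * n)"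
    using connected_asm_exists[OF assms] connected_asm_iff n by blast
  have D: "is_asm A" "cut_connected n A" if "A \<in> carrier_mat n n" "connected_asm A" for A
    using that connected_asm_iff n by blast+
  have lower: "(if odd n then 2 * n - 1 else 2 * n) \<le> num_nonzero A"
    if A: "A \<in> carrier_mat n n" "connected_asm A" for A
  proof (cases "odd n")
    case False
    \<comment> \<open>The general bound is \<open>2 * n - 1\<close>; for even \<open>n\<close>
      parity excludes this odd value.\<close>
    then have "num_nonzero A \<noteq> 2 * n - 1" using num_nonzero_parity[OF A(1) D(1)[OF A]] n by auto
    then show ?thesis using connected_asm_decomposition(1)[OF A(1) D[OF A] n] False by simp
  qed (use connected_asm_decomposition(1)[OF A(1) D[OF A] n] in simp)
  have odd_iff: "num_nonzero A = 2 * n - 1 \<longleftrightarrow> A = 1\<^sub>m 1 \<or> attaches_D3s (1\<^sub>m 1) A"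
    if A: "A \<in> carrier_mat n n" "connected_asm A" for A
  proof
    assume "num_nonzero A = 2 * n - 1"
    then show "A = 1\<^sub>m 1 \<or> attaches_D3s (1\<^sub>m 1) A"
      using connected_asm_decomposition(2)[OF A(1) D[OF A] n] by blast
  next
    assume "A = 1\<^sub>m 1 \<or> attaches_D3s (1\<^sub>m 1) A"
    then have "attaches_D3s (1\<^sub>m 1) A" by auto
    then obtain k where k: "A \<in> carrier_mat k k" "num_nonzero A + 2 * 1 = num_nonzero (1\<^sub>m 1) + 2 * k"
      using attaches_D3s_num_nonzero[of "1\<^sub>m 1" A 1] by auto
    then have "k = n" using A(1) by auto
    then show "num_nonzero A = 2 * n - 1" using k(2) num_nonzero_one by simp
  qed
  have even_iff: "num_nonzero A = 2 * n \<longleftrightarrow>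
      basic_unicyclic_asm A \<or> (\<exists>B. basic_unicyclic_asm B \<and> attaches_D3s B A)"
    if A: "A \<in> carrier_mat n n" "connected_asm A" and even: "even n" for A
  proof
    assume "num_nonzero A = 2 * n"
    then show "basic_unicyclic_asm A \<or> (\<exists>B. basic_unicyclic_asm B \<and> attaches_D3s B A)"
      using connected_asm_decomposition(3)[OF A(1) D[OF A] n] by blast
  next
    assume "basic_unicyclic_asm A \<or> (\<exists>B. basic_unicyclic_asm B \<and> attaches_D3s B A)"
    then obtain B where B: "basic_unicyclic_asm B" "attaches_D3s B A" by blast
    then have "square_mat B" by (simp add: basic_unicyclic_asm_def is_asm_def)
    then have "dim_col B = dim_row B" by simp
    then have Bm: "B \<in> carrier_mat (dim_row B) (dim_row B)" by (intro carrier_matI refl)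
    obtain k where k: "A \<in> carrier_mat k k" "num_nonzero A + 2 * dim_row B = num_nonzero B + 2 * k"
      using attaches_D3s_num_nonzero[OF B(2) Bm] by blast
    then have "k = n" using A(1) by auto
    \<comment> \<open>The excess of \<open>A\<close> equals that of \<open>B\<close>, which is at
      most 0; the lower bound for even \<open>n\<close> gives the rest.\<close>
    then have "num_nonzero A \<le> 2 * n" using k(2) basic_unicyclic_asm_num_nonzero[OF B(1) Bm] by simp
    then show "num_nonzero A = 2 * n" using lower[OF A] even by simp
  qed
  show ?thesis
  proof (intro conjI impI ballI)
    fix A :: "int mat" assume A: "A \<in> carrier_mat n n" "connected_asm A"
    show "(if odd n then 2 * n - 1 else 2 * n) \<le> num_nonzero A" by (rule lower[OF A])
    show "num_nonzero A = 2 * n - 1 \<longleftrightarrow> A = 1\<^sub>m 1 \<or> attaches_D3s (1\<^sub>m 1) A" by (rule odd_iff[OF A])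
    assume "even n"
    then show "num_nonzero A = 2 * n \<longleftrightarrow>
      basic_unicyclic_asm A \<or> (\<exists>B. basic_unicyclic_asm B \<and> attaches_D3s B A)" by (rule even_iff[OF A])
  qed (rule ex)
qed

end
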